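(* Let $A$ be a separable unital $C^*$-algebra, let $\tau$ be a faithful tracial state on $A$, let $N$ be the weak closure of $A$ under the GNS representation of $A$ with respect to the state $\tau$, and let $\omega$ be a free ultrafilter on $\mathbb{N}$. Then the natural $^*$-homomorphisms $$A_\omega\to N^\omega,\qquad A_\omega\cap A'\to N^\omega\cap N'$$ are surjective.
   Context: $A_\omega=\ell^\infty(A)/\{(a_n)\in\ell^\infty(A):\lim_{n\to\omega}\|a_n\|=0\}$. The trace $\tau$ extends to a faithful normal tracial state on $N$, again denoted $\tau$; $\|x\|_{2,\tau}=\tau(x^*x)^{1/2}$ for $x\in N$; and $N^\omega=\ell^\infty(N)/\{(x_n)\in\ell^\infty(N):\lim_{n\to\omega}\|x_n\|_{2,\tau}=0\}$. $A$ is viewed as a subalgebra of $N$ via the GNS representation, and $A$ and $N$ are embedded in $A_\omega$ and $N^\omega$, respectively, as constant sequences. The natural map $A_\omega\to N^\omega$ sends the class of $(a_n)_n\in\ell^\infty(A)$ to the class of $(a_n)_n$ in $N^\omega$; it maps $A_\omega\cap A'$ into $N^\omega\cap N'$, and the second map is its restriction. *)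

theory Defs
  imports "HOL-Analysis.Analysis" "HOL-Algebra.QuotRing" "HOL-Algebra.Module"
begin

section \<open>Complex normed spaces, Hilbert spaces and unital C*-algebras\<close>

class cscale =
  fixes cscale :: "complex \<Rightarrow> 'a \<Rightarrow> 'a"  (infixr \<open>*\<^sub>C\<close> 75)

class complex_vector = real_vector + cscale +
  assumes cscale_add_right: "c *\<^sub>C (x + y) = c *\<^sub>C x + c *\<^sub>C y"
    and cscale_add_left: "(c + d) *\<^sub>C x = c *\<^sub>C x + d *\<^sub>C x"
    and cscale_cscale: "c *\<^sub>C (d *\<^sub>C x) = (c * d) *\<^sub>C x"
    and scaleR_cscale: "r *\<^sub>R x = complex_of_real r *\<^sub>C x"

class complex_normed_vector = complex_vector + real_normed_vector +
  assumes norm_cscale: "norm (c *\<^sub>C x) = cmod c * norm x"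

text \<open>The inner product is linear in the first argument. Positive definiteness and
  \<open>\<parallel>x\<parallel>\<^sup>2 = \<langle>x, x\<rangle>\<close> come from the axioms of \<^class>\<open>real_inner\<close> for its real part.\<close>

class complex_hilbert_space = complex_normed_vector + real_inner + complete_space +
  fixes cinner :: "'a \<Rightarrow> 'a \<Rightarrow> complex"
  assumes cinner_commute: "cinner x y = cnj (cinner y x)"
    and cinner_add_left: "cinner (x + y) z = cinner x z + cinner y z"
    and cinner_cscale_left: "cinner (c *\<^sub>C x) y = c * cinner x y"
    and Re_cinner: "Re (cinner x y) = inner x y"

text \<open>The class \<^class>\<open>real_normed_algebra_1\<close> forces \<open>1 \<noteq> 0\<close>; this excludes only the zero
  algebra, which has no states.\<close>

class unital_cstar_algebra = complex_normed_vector + real_normed_algebra_1 + banach +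
  fixes star :: "'a \<Rightarrow> 'a"
  assumes mult_cscale_left: "(c *\<^sub>C x) * y = c *\<^sub>C (x * y)"
    and mult_cscale_right: "x * (c *\<^sub>C y) = c *\<^sub>C (x * y)"
    and star_star: "star (star x) = x"
    and star_add: "star (x + y) = star x + star y"
    and star_cscale: "star (c *\<^sub>C x) = cnj c *\<^sub>C star x"
    and star_mult: "star (x * y) = star y * star x"
    and cstar_identity: "norm (star x * x) = (norm x)\<^sup>2"

definition clinear_functional :: "('a::complex_vector \<Rightarrow> complex) \<Rightarrow> bool" where
  "clinear_functional f \<longleftrightarrow>
     (\<forall>x y. f (x + y) = f x + f y) \<and> (\<forall>c x. f (c *\<^sub>C x) = c * f x)"

definition state :: "('a::unital_cstar_algebra \<Rightarrow> complex) \<Rightarrow> bool" where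
  "state \<tau> \<longleftrightarrow> clinear_functional \<tau> \<and> (\<forall>a. \<tau> (star a * a) \<in> \<real>\<^sub>\<ge>\<^sub>0) \<and> \<tau> 1 = 1"

definition tracial :: "('a::unital_cstar_algebra \<Rightarrow> complex) \<Rightarrow> bool" where
  "tracial \<tau> \<longleftrightarrow> (\<forall>a b. \<tau> (a * b) = \<tau> (b * a))"

definition faithful :: "('a::unital_cstar_algebra \<Rightarrow> complex) \<Rightarrow> bool" where
  "faithful \<tau> \<longleftrightarrow> (\<forall>a. \<tau> (star a * a) = 0 \<longrightarrow> a = 0)"

section \<open>*-algebras as structures with a carrier\<close>

text \<open>The sequence algebras and their quotients depend on \<open>\<tau>\<close> and \<open>\<omega>\<close>, so they cannot be types.
  They are records that extend the ring records of HOL-Algebra.\<close>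

record 'b star_algebra = "(complex, 'b) module" +
  involution :: "'b \<Rightarrow> 'b"

definition star_hom ::
  "('a, 'm) star_algebra_scheme \<Rightarrow> ('b, 'n) star_algebra_scheme \<Rightarrow> ('a \<Rightarrow> 'b) set" where
  "star_hom M N = {h \<in> ring_hom M N.
     (\<forall>c. \<forall>x\<in>carrier M. h (c \<odot>\<^bsub>M\<^esub> x) = c \<odot>\<^bsub>N\<^esub> h x) \<and>
     (\<forall>x\<in>carrier M. h (involution M x) = involution N (h x))}"

definition relative_commutant :: "('a, 'm) star_algebra_scheme \<Rightarrow> 'a set \<Rightarrow> 'a set" where
  "relative_commutant M S = {x \<in> carrier M. \<forall>s\<in>S. x \<otimes>\<^bsub>M\<^esub> s = s \<otimes>\<^bsub>M\<^esub> x}"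

definition cstar_alg :: "'a::unital_cstar_algebra star_algebra" where
  "cstar_alg = \<lparr>carrier = UNIV, mult = (*), one = 1, zero = 0, add = (+),
     smult = (*\<^sub>C), involution = star\<rparr>"

section \<open>Bounded operators on a Hilbert space\<close>

text \<open>The type \<open>'h \<Rightarrow>\<^sub>L 'h\<close> consists of the bounded real-linear operators; \<open>B(H)\<close> is the
  subset of the complex-linear ones, with the same operator norm.\<close>

lift_definition blinfun_cscale ::
  "complex \<Rightarrow> ('h::complex_hilbert_space \<Rightarrow>\<^sub>L 'h) \<Rightarrow> ('h \<Rightarrow>\<^sub>L 'h)" is "\<lambda>c T x. c *\<^sub>C T x"
proof -
  fix c :: complex and T :: "'h \<Rightarrow> 'h"
  assume T: "bounded_linear T"
  interpret T: bounded_linear T by (fact T)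
  obtain K where K: "\<And>x. norm (T x) \<le> norm x * K"
    using T.bounded by blast
  show "bounded_linear (\<lambda>x. c *\<^sub>C T x)"
  proof (rule bounded_linear_intro)
    show "c *\<^sub>C T (x + y) = c *\<^sub>C T x + c *\<^sub>C T y" for x y
      by (simp add: T.add cscale_add_right)
    show "c *\<^sub>C T (r *\<^sub>R x) = r *\<^sub>R (c *\<^sub>C T x)" for r x
      by (simp only: T.scaleR) (simp add: scaleR_cscale cscale_cscale mult.commute)
    show "norm (c *\<^sub>C T x) \<le> norm x * (cmod c * K)" for x
      using mult_left_mono[OF K, of "cmod c" x] by (simp add: norm_cscale ac_simps)
  qed
qed

definition op_adjoint ::
  "('h::complex_hilbert_space \<Rightarrow>\<^sub>L 'h) \<Rightarrow> ('h \<Rightarrow>\<^sub>L 'h)" where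
  "op_adjoint T = (THE S. \<forall>x y.
     cinner (blinfun_apply T x) y = cinner x (blinfun_apply S y))"

definition bounded_ops :: "('h::complex_hilbert_space \<Rightarrow>\<^sub>L 'h) star_algebra" where
  "bounded_ops = \<lparr>carrier = {T. \<forall>c x. blinfun_apply T (c *\<^sub>C x) = c *\<^sub>C blinfun_apply T x},
     mult = (o\<^sub>L), one = id_blinfun, zero = 0, add = (+),
     smult = blinfun_cscale, involution = op_adjoint\<rparr>"

text \<open>Coarsest topology on \<open>B(H)\<close> for which all \<open>T \<mapsto> \<langle>T x, y\<rangle>\<close> are continuous
  (cf. \<^const>\<open>strong_operator_topology\<close>); \<^const>\<open>euclidean\<close> is the product topology here.\<close>

definition weak_operator_topology ::
  "('h::complex_hilbert_space \<Rightarrow>\<^sub>L 'h) topology" where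
  "weak_operator_topology =
     pullback_topology (carrier bounded_ops) (\<lambda>T (x, y). cinner (blinfun_apply T x) y) euclidean"

section \<open>The GNS representation\<close>

text \<open>The GNS representation of a state is unique up to unitary equivalence: it is a
  *-representation \<open>\<pi>\<close> on a Hilbert space with a cyclic vector \<open>\<xi>\<close> that implements the state.\<close>

definition gns_representation ::
  "('a::unital_cstar_algebra \<Rightarrow> complex) \<Rightarrow> ('a \<Rightarrow> ('h::complex_hilbert_space \<Rightarrow>\<^sub>L 'h)) \<Rightarrow> 'h \<Rightarrow> bool"
where
  "gns_representation \<tau> \<pi> \<xi> \<longleftrightarrow>
     \<pi> \<in> star_hom cstar_alg bounded_ops \<and>
     closure (range (\<lambda>a. blinfun_apply (\<pi> a) \<xi>)) = UNIV \<and>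
     (\<forall>a. \<tau> a = cinner (blinfun_apply (\<pi> a) \<xi>) \<xi>)"

definition gns_closure ::
  "('a \<Rightarrow> ('h::complex_hilbert_space \<Rightarrow>\<^sub>L 'h)) \<Rightarrow> ('h \<Rightarrow>\<^sub>L 'h) star_algebra" where
  "gns_closure \<pi> = bounded_ops\<lparr>carrier := weak_operator_topology closure_of range \<pi>\<rparr>"

text \<open>The normal extension of \<open>\<tau>\<close> to the weak closure is the vector state of \<open>\<xi>\<close>.\<close>

definition gns_trace ::
  "'h::complex_hilbert_space \<Rightarrow> ('h \<Rightarrow>\<^sub>L 'h) \<Rightarrow> complex" where
  "gns_trace \<xi> x = cinner (blinfun_apply x \<xi>) \<xi>"

definition two_norm ::
  "'h::complex_hilbert_space \<Rightarrow> ('h \<Rightarrow>\<^sub>L 'h) \<Rightarrow> real" where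
  "two_norm \<xi> x = sqrt (Re (gns_trace \<xi> (op_adjoint x o\<^sub>L x)))"

section \<open>Ultrapowers\<close>

definition free_ultrafilter :: "nat filter \<Rightarrow> bool" where
  "free_ultrafilter \<omega> \<longleftrightarrow> \<omega> \<noteq> bot \<and>
     (\<forall>P. eventually P \<omega> \<or> eventually (\<lambda>n. \<not> P n) \<omega>) \<and>
     (\<forall>m. eventually (\<lambda>n. n \<noteq> m) \<omega>)"

definition linf ::
  "('b::real_normed_vector, 'm) star_algebra_scheme \<Rightarrow> (nat \<Rightarrow> 'b) star_algebra" where
  "linf M = \<lparr>carrier = {X. range X \<subseteq> carrier M \<and> bounded (range X)},
     mult = (\<lambda>X Y n. X n \<otimes>\<^bsub>M\<^esub> Y n), one = (\<lambda>n. \<one>\<^bsub>M\<^esub>), zero = (\<lambda>n. \<zero>\<^bsub>M\<^esub>),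
     add = (\<lambda>X Y n. X n \<oplus>\<^bsub>M\<^esub> Y n),
     smult = (\<lambda>c X n. c \<odot>\<^bsub>M\<^esub> X n), involution = (\<lambda>X n. involution M (X n))\<rparr>"

definition null_seqs ::
  "nat filter \<Rightarrow> ('b \<Rightarrow> real) \<Rightarrow> ('b::real_normed_vector, 'm) star_algebra_scheme
     \<Rightarrow> (nat \<Rightarrow> 'b) set" where
  "null_seqs \<omega> \<nu> M = {X \<in> carrier (linf M). ((\<lambda>n. \<nu> (X n)) \<longlongrightarrow> 0) \<omega>}"

definition star_quotient ::
  "('b, 'm) star_algebra_scheme \<Rightarrow> 'b set \<Rightarrow> 'b set star_algebra" where
  "star_quotient M I = ring.extend (M Quot I)
     \<lparr>smult = (\<lambda>c X. \<Union>x\<in>X. I +>\<^bsub>M\<^esub> (c \<odot>\<^bsub>M\<^esub> x)),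
      involution = (\<lambda>X. \<Union>x\<in>X. I +>\<^bsub>M\<^esub> involution M x)\<rparr>"

definition ultrapower ::
  "nat filter \<Rightarrow> ('b \<Rightarrow> real) \<Rightarrow> ('b::real_normed_vector, 'm) star_algebra_scheme
     \<Rightarrow> (nat \<Rightarrow> 'b) set star_algebra" where
  "ultrapower \<omega> \<nu> M = star_quotient (linf M) (null_seqs \<omega> \<nu> M)"

definition ultra_class ::
  "nat filter \<Rightarrow> ('b \<Rightarrow> real) \<Rightarrow> ('b::real_normed_vector, 'm) star_algebra_scheme
     \<Rightarrow> (nat \<Rightarrow> 'b) \<Rightarrow> (nat \<Rightarrow> 'b) set" where
  "ultra_class \<omega> \<nu> M X = null_seqs \<omega> \<nu> M +>\<^bsub>linf M\<^esub> X"

text \<open>For an ultrapower \<open>Q\<close> of \<open>M\<close>: the *-algebra \<open>Q \<inter> M'\<close>, where \<open>M\<close> is embedded as the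
  classes of constant sequences.\<close>

definition central_ultrapower ::
  "nat filter \<Rightarrow> ('b \<Rightarrow> real) \<Rightarrow> ('b::real_normed_vector, 'm) star_algebra_scheme
     \<Rightarrow> (nat \<Rightarrow> 'b) set star_algebra" where
  "central_ultrapower \<omega> \<nu> M = (ultrapower \<omega> \<nu> M)
     \<lparr>carrier := relative_commutant (ultrapower \<omega> \<nu> M)
        ((\<lambda>b. ultra_class \<omega> \<nu> M (\<lambda>n. b)) ` carrier M)\<rparr>"

text \<open>The class of \<open>(a\<^sub>n)\<close> in \<open>A\<^sub>\<omega>\<close> goes to the class of \<open>(\<pi> a\<^sub>n)\<close> in \<open>N\<^sup>\<omega>\<close>. The
  union is over all representatives; it is a single class exactly when the result does not depend
  on the representative.\<close>

definition natural_map ::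
  "nat filter \<Rightarrow> ('a \<Rightarrow> ('h::complex_hilbert_space \<Rightarrow>\<^sub>L 'h)) \<Rightarrow> 'h
     \<Rightarrow> (nat \<Rightarrow> 'a) set \<Rightarrow> (nat \<Rightarrow> ('h \<Rightarrow>\<^sub>L 'h)) set" where
  "natural_map \<omega> \<pi> \<xi> X =
     (\<Union>a\<in>X. ultra_class \<omega> (two_norm \<xi>) (gns_closure \<pi>) (\<lambda>n. \<pi> (a n)))"

end

theory Submission
  imports Defs
begin

text \<open>Both surjectivity statements reduce to approximation results with explicit bounds.

  For \<open>A\<^sub>\<omega> \<rightarrow> N\<^sup>\<omega>\<close> one needs Kaplansky's density theorem up to a constant. A small selfadjoint
  \<open>x \<in> N\<close> has the form \<open>y (1 + y\<^sup>2)\<^sup>-\<^sup>1\<close> with \<open>y \<in> N\<close>; if \<open>a \<in> A\<close> is selfadjoint and close to \<open>y\<close> in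
  the 2-norm, then \<open>a (1 + a\<^sup>2)\<^sup>-\<^sup>1\<close> is close to \<open>x\<close> and is a contraction, since it is essentially
  the imaginary part of the unitary Cayley transform of \<open>a\<close>.

  For the relative commutants, lift a central sequence of \<open>N\<close> to a bounded sequence \<open>(a\<^sub>n)\<close> in \<open>A\<close>.
  Its commutators with elements of \<open>A\<close> lie in the ideal of 2-norm null sequences. This ideal has
  quasicentral approximate units \<open>(1 - p\<^sub>n)\<close>, and \<open>(p\<^sub>n a\<^sub>n)\<close> is a lift that commutes with \<open>A\<close> in norm.
  Quasicentrality is obtained without functional calculus or convexity: average \<open>L\<close> successive
  approximate units whose commutators with \<open>A\<close> are almost orthogonal, so that the commutators of
  the average have norm of order \<open>1 / sqrt L\<close>.\<close>

text \<open>Traciality makes the 2-norm two-sided: \<open>T \<xi>\<close> and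
  \<open>op_adjoint T \<xi>\<close> have the same norm for T in N, so right multiplication is
  bounded as well as left multiplication, and the 2-norm null sequences form a two-sided ideal.
  Approximants in the 2-norm come from cyclicity of \<xi>, with no comparison of weak and strong
  closures, but nothing is known about their operator norms. This obstacle is the reason for the
  bounded function t / (1 + t^2): the approximant a enters the error only through the contractions
  (1 + a^2)^-1 and a (1 + a^2)^-1. The constants 2 for the norm of \<pi> and 8 for density are not
  sharp; an element of an ultrapower only has to be lifted to some bounded sequence. The almost
  orthogonality in the second argument is forced by choosing the units successively: each absorbs
  the products of the earlier sum with the elements to be commuted with.\<close>

lemma cscale_zero_right [simp]: "c *\<^sub>C (0::'a::complex_vector) = 0"
  using cscale_add_right[of c "0::'a" 0] by simp

lemma cscale_minus_right: "c *\<^sub>C (- x) = - (c *\<^sub>C (x::'a::complex_vector))"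
  using cscale_add_right[of c x "- x"] by (simp add: add_eq_0_iff)

lemma cscale_diff_right: "c *\<^sub>C (x - y) = c *\<^sub>C x - c *\<^sub>C (y::'a::complex_vector)"
  using cscale_add_right[of c x "- y"] by (simp add: cscale_minus_right)

lemma cscale_of_real: "complex_of_real r *\<^sub>C x = r *\<^sub>R (x::'a::complex_vector)"
  by (simp add: scaleR_cscale)

lemma cscale_minus_one: "(-1) *\<^sub>C x = - (x::'a::complex_vector)"
  using cscale_of_real[of "-1" x] by simp

lemma cscale_minus_left: "(- c) *\<^sub>C x = - (c *\<^sub>C (x::'a::complex_vector))"
  using cscale_cscale[of "-1" c x] by (simp add: cscale_minus_one)

lemma cscale_ii_ii: "\<i> *\<^sub>C \<i> *\<^sub>C x = - (x::'a::complex_vector)"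
  by (simp add: cscale_cscale cscale_minus_one)

section \<open>Unital C*-algebras\<close>

lemma star_zero [simp]: "star (0::'a::unital_cstar_algebra) = 0"
  using star_add[of "0::'a" 0] by simp

lemma star_minus: "star (- x) = - star (x::'a::unital_cstar_algebra)"
  using star_add[of x "- x"] by (simp add: add_eq_0_iff)

lemma star_diff: "star (x - y) = star x - star (y::'a::unital_cstar_algebra)"
  using star_add[of x "- y"] by (simp add: star_minus)

lemma star_scaleR: "star (r *\<^sub>R x) = r *\<^sub>R star (x::'a::unital_cstar_algebra)"
  by (simp add: scaleR_cscale star_cscale)

lemma star_one [simp]: "star (1::'a::unital_cstar_algebra) = 1"
proof -
  have "star (star (1::'a) * 1) = star 1 * star (star 1)"
    by (simp only: star_mult)
  then show ?thesis by (simp add: star_star)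
qed

lemma norm_star [simp]: "norm (star x) = norm (x::'a::unital_cstar_algebra)"
proof -
  have le: "norm y \<le> norm (star y)" for y :: 'a
  proof (cases "y = 0")
    case False
    have "norm y * norm y \<le> norm (star y) * norm y"
      by (metis cstar_identity norm_mult_ineq power2_eq_square)
    then show ?thesis using False by simp
  qed simp
  from le[of x] le[of "star x"] show ?thesis by (simp add: star_star)
qed

lemma continuous_on_star: "continuous_on S (star :: 'a::unital_cstar_algebra \<Rightarrow> 'a)"
proof (rule continuous_on_subset)
  show "continuous_on UNIV (star :: 'a \<Rightarrow> 'a)"
    unfolding continuous_on_iff
    by (metis dist_norm norm_star star_diff)
qed simp

section \<open>Inverses, resolvent bounds and square roots by contraction arguments\<close>

lemma one_minus_invertible:
  fixes k :: "'a::{real_normed_algebra_1, banach}"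
  assumes "norm k < 1"
  shows "\<exists>s. (1 - k) * s = 1 \<and> s * (1 - k) = 1"
proof -
  \<comment> \<open>Fixed points of \<open>1 + k * s\<close> and \<open>1 + s * k\<close> are a
    right and a left inverse of \<open>1 - k\<close>; both maps contract by the factor
    \<open>norm k\<close>.\<close>
  have "\<exists>!s. 1 + k * s = s"
    using assms
    by (intro banach_fix_type[of "norm k"])
       (auto simp: dist_norm norm_mult_ineq simp flip: right_diff_distrib)
  then obtain s where "1 + k * s = s" by blast
  then have s: "(1 - k) * s = 1" by (simp add: left_diff_distrib eq_diff_eq diff_eq_eq)
  have "\<exists>!s. 1 + s * k = s"
    using assms
    by (intro banach_fix_type[of "norm k"])
       (auto simp: dist_norm norm_mult_ineq mult.commute[of "norm k"] simp flip: left_diff_distrib)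
  then obtain t where "1 + t * k = t" by blast
  then have t: "t * (1 - k) = 1" by (simp add: right_diff_distrib eq_diff_eq diff_eq_eq)
  have "t = s" using s t by (metis mult.assoc mult.left_neutral mult.right_neutral)
  with s t show ?thesis by blast
qed

text \<open>The Cayley transform \<open>2 r - 1 = (1 + k) r\<close> is unitary.\<close>

lemma skew_resolvent_norm_le_1:
  fixes k :: "'a::unital_cstar_algebra"
  assumes k: "star k = - k" and r: "(1 - k) * r = 1" "r * (1 - k) = 1"
  shows "norm r \<le> 1"
proof -
  define u where "u = (1 + k) * r"
  have u2: "u = 2 *\<^sub>R r - 1"
  proof -
    have "u + (1 - k) * r = 2 *\<^sub>R r" by (simp add: u_def algebra_simps scaleR_2)
    then show ?thesis by (simp add: r(1) eq_diff_eq)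
  qed
  have sr: "star r * (1 + k) = 1"
    using arg_cong[OF r(1), of star] by (simp add: star_mult star_diff k)
  have "star u * u = star r * ((1 - k) * (1 + k)) * r"
    by (simp add: u_def star_mult star_add k mult.assoc)
  also have "(1 - k) * (1 + k) = (1 + k) * (1 - k)" by (simp add: algebra_simps)
  also have "star r * ((1 + k) * (1 - k)) * r = (star r * (1 + k)) * ((1 - k) * r)"
    by (simp add: mult.assoc)
  finally have "star u * u = 1" by (simp add: sr r(1))
  then have "norm u = 1" using cstar_identity[of u] norm_ge_zero[of u] by (auto simp: power2_eq_1_iff)
  moreover have "2 * norm r \<le> norm u + 1"
    using norm_triangle_ineq[of u 1] by (simp add: u2)
  ultimately show ?thesis by simp
qed

text \<open>Continuation from 0 to \<open>k\<close> in \<open>m\<close> steps of norm below 1. Each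
  intermediate resolvent belongs to a skew element again and has norm at most 1, so the admissible
  step length never shrinks.\<close>

lemma skew_resolvent_exists:
  fixes k :: "'a::unital_cstar_algebra"
  assumes k: "star k = - k"
  shows "\<exists>r. (1 - k) * r = 1 \<and> r * (1 - k) = 1"
proof -
  obtain m :: nat where m: "norm k < real m" using reals_Archimedean2 by blast
  then have m0: "0 < real m" by (meson norm_ge_zero order_le_less_trans)
  define j where "j = (1 / real m) *\<^sub>R k"
  have nj: "norm j < 1" using m m0 by (simp add: j_def)
  have sj: "star j = - j" by (simp add: j_def star_scaleR k)
  have "\<exists>r. (1 - real n *\<^sub>R j) * r = 1 \<and> r * (1 - real n *\<^sub>R j) = 1" for n :: nat
  proof (induction n)
    case 0 show ?case by (rule exI[of _ 1]) simp
  next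
    case (Suc n)
    then obtain r where r: "(1 - real n *\<^sub>R j) * r = 1" "r * (1 - real n *\<^sub>R j) = 1" by blast
    have "norm r \<le> 1"
      by (rule skew_resolvent_norm_le_1[OF _ r]) (simp add: star_scaleR sj)
    then have "norm (r * j) < 1"
      using norm_mult_ineq[of r j] nj mult_left_le_one_le[of "norm j" "norm r"] by (simp add: mult.commute)
    then obtain s where s: "(1 - r * j) * s = 1" "s * (1 - r * j) = 1"
      using one_minus_invertible by blast
    have eq: "1 - real (Suc n) *\<^sub>R j = (1 - real n *\<^sub>R j) * (1 - r * j)"
    proof -
      have "(1 - real n *\<^sub>R j) * (1 - r * j) = (1 - real n *\<^sub>R j) - ((1 - real n *\<^sub>R j) * r) * j"
        by (simp only: right_diff_distrib mult.assoc mult_1_right)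
      then show ?thesis by (simp add: r(1) scaleR_left_distrib)
    qed
    show ?case
    proof (intro exI conjI)
      have "(1 - real n *\<^sub>R j) * (1 - r * j) * (s * r) = (1 - real n *\<^sub>R j) * ((1 - r * j) * s) * r"
        by (simp only: mult.assoc)
      then show "(1 - real (Suc n) *\<^sub>R j) * (s * r) = 1"
        unfolding eq by (simp add: r s)
      have "(s * r) * ((1 - real n *\<^sub>R j) * (1 - r * j)) = s * (r * (1 - real n *\<^sub>R j)) * (1 - r * j)"
        by (simp only: mult.assoc)
      then show "(s * r) * (1 - real (Suc n) *\<^sub>R j) = 1"
        unfolding eq by (simp add: r s)
    qed
  qed
  from this[of m] show ?thesis using m0 by (simp add: j_def)
qed

text \<open>With k = ia the element factors as (1 - k)(1 + k); if \<open>r\<close> inverts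
  \<open>1 - k\<close>, then \<open>star r\<close> inverts \<open>1 + k\<close>, and
  \<open>q\<close> is \<open>star r * r\<close>. The bound on \<open>q * a\<close> does not depend
  on \<open>norm a\<close>, so it serves for approximants of unknown size.\<close>

lemma one_plus_square_invertible:
  fixes a :: "'a::unital_cstar_algebra"
  assumes a: "star a = a"
  obtains q where "star q = q" "q * (1 + a * a) = 1" "(1 + a * a) * q = 1"
    "norm q \<le> 1" "norm (q * a) \<le> 1"
proof -
  define k where "k = \<i> *\<^sub>C a"
  have k: "star k = - k"
    using cscale_add_left[of \<i> "-\<i>" a] cscale_of_real[of 0 a]
    by (simp add: k_def star_cscale a add_eq_0_iff)
  have kk: "1 + a * a = (1 - k) * (1 + k)"
    by (simp add: k_def distrib_left left_diff_distrib mult_cscale_left mult_cscale_right cscale_ii_ii cscale_diff_right)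
  obtain r where r: "(1 - k) * r = 1" "r * (1 - k) = 1"
    using skew_resolvent_exists[OF k] by blast
  have sr: "star r * (1 + k) = 1" "(1 + k) * star r = 1"
    using arg_cong[OF r(1), of star] arg_cong[OF r(2), of star] by (simp_all add: star_mult star_diff k)
  have nr: "norm r \<le> 1" by (rule skew_resolvent_norm_le_1[OF k r])
  show ?thesis
  proof
    show "star (star r * r) = star r * r" by (simp add: star_mult star_star)
    show "star r * r * (1 + a * a) = 1"
    proof -
      have "star r * r * ((1 - k) * (1 + k)) = star r * (r * (1 - k)) * (1 + k)"
        by (simp only: mult.assoc)
      then show ?thesis by (simp add: kk r sr)
    qed
    show "(1 + a * a) * (star r * r) = 1"
    proof -
      have "(1 - k) * (1 + k) * (star r * r) = (1 - k) * ((1 + k) * star r) * r"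
        by (simp only: mult.assoc)
      then show ?thesis by (simp add: kk r sr)
    qed
    show "norm (star r * r) \<le> 1"
      using nr by (simp add: cstar_identity power_le_one)
    have rk: "r * k = k * r"
    proof -
      have "r - k * r = r - r * k" using r by (simp add: left_diff_distrib right_diff_distrib)
      then show ?thesis by simp
    qed
    \<comment> \<open>Inserting 1 as \<open>star r * (1 + k)\<close> and as
      \<open>(1 - k) * r\<close> exhibits \<open>star r * r * k\<close> as half of
      \<open>r - star r\<close>, hence as a contraction.\<close>
    have "r - star r = star r * (1 + k) * r - star r * ((1 - k) * r)"
      by (simp add: sr r)
    also have "\<dots> = 2 *\<^sub>R (star r * k * r)" by (simp add: algebra_simps scaleR_2)
    also have "star r * k * r = star r * r * k" by (simp add: mult.assoc rk)
    finally have "2 * norm (star r * r * k) = norm (r - star r)" by simp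
    also have "\<dots> \<le> 2" using norm_triangle_ineq4[of r "star r"] nr by simp
    finally have "norm (star r * r * k) \<le> 1" by simp
    then show "norm (star r * r * a) \<le> 1"
      by (simp add: k_def mult_cscale_right norm_cscale)
  qed
qed

text \<open>The substitution c = 1 - d leads to the fixed point equation d = (h + d^2) / 2, a
  contraction with factor 1/2 on the closed set of selfadjoint elements of norm at most 1/2.\<close>

lemma one_minus_is_square:
  fixes h :: "'a::unital_cstar_algebra"
  assumes h: "star h = h" "norm h \<le> 1/2"
  shows "\<exists>c. star c = c \<and> 1 - h = c * c"
proof -
  define S where "S = {d::'a. star d = d} \<inter> cball 0 (1/2)"
  have "closed S"
    unfolding S_def by (intro closed_Int closed_Collect_eq continuous_on_star continuous_on_id closed_cball)
  then have "complete S" by (simp add: complete_eq_closed)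
  moreover have "S \<noteq> {}" by (auto simp: S_def set_eq_iff intro!: exI[of _ 0])
  moreover have "(\<lambda>d. (1/2) *\<^sub>R (h + d * d)) ` S \<subseteq> S"
  proof clarify
    fix d assume d: "d \<in> S"
    have "norm (d * d) \<le> (1/2) * (1/2)"
      using norm_mult_ineq[of d d] d mult_mono[of "norm d" "1/2" "norm d" "1/2"] by (simp add: S_def)
    then have "norm (h + d * d) \<le> 1" using norm_triangle_ineq[of h "d * d"] h by simp
    then show "(1/2) *\<^sub>R (h + d * d) \<in> S"
      using d by (simp add: S_def star_scaleR star_add star_mult h)
  qed
  moreover have "dist ((1/2) *\<^sub>R (h + x * x)) ((1/2) *\<^sub>R (h + y * y)) \<le> (1/2) * dist x y"
    if "x \<in> S" "y \<in> S" for x y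
  proof -
    have "norm (x * (x - y) + (x - y) * y) \<le> norm x * norm (x - y) + norm (x - y) * norm y"
      by (intro norm_triangle_le add_mono norm_mult_ineq)
    also have "\<dots> \<le> (1/2) * norm (x - y) + norm (x - y) * (1/2)"
      using that by (intro add_mono mult_right_mono mult_left_mono) (auto simp: S_def)
    finally have "norm (x * x - y * y) \<le> norm (x - y)" by (simp add: algebra_simps)
    then show ?thesis by (simp add: dist_norm flip: scaleR_diff_right)
  qed
  ultimately have "\<exists>!d\<in>S. (1/2) *\<^sub>R (h + d * d) = d"
    by (intro Banach_fix[where c = "1/2"]) auto
  then obtain d where d: "d \<in> S" "(1/2) *\<^sub>R (h + d * d) = d" by blast
  have "h + d * d = 2 *\<^sub>R ((1/2) *\<^sub>R (h + d * d))" by (simp only: scaleR_scaleR) simp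
  also have "\<dots> = d + d" unfolding d(2) by (simp add: scaleR_2)
  finally have "h = d + d - d * d" by (simp add: eq_diff_eq)
  then have "1 - h = (1 - d) * (1 - d)" by (simp add: left_diff_distrib right_diff_distrib)
  moreover have "star (1 - d) = 1 - d" using d by (simp add: S_def star_diff)
  ultimately show ?thesis by blast
qed

section \<open>Quasicentral approximate units for two-sided seminorms\<close>

lemma bounded_range_iff: "bounded (range f) \<longleftrightarrow> (\<exists>R\<ge>0. \<forall>n. norm (f n) \<le> R)"
  unfolding bounded_iff by (auto intro: order_trans[OF norm_ge_zero])

lemma bounded_range_mult:
  fixes f g :: "nat \<Rightarrow> 'a::real_normed_algebra"
  assumes "bounded (range f)" "bounded (range g)"
  shows "bounded (range (\<lambda>n. f n * g n))"
proof -
  from assms obtain R S where "R \<ge> 0" "S \<ge> 0" "\<And>n. norm (f n) \<le> R" "\<And>n. norm (g n) \<le> S"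
    by (auto simp: bounded_range_iff)
  then have "norm (f n * g n) \<le> R * S" for n
    by (meson mult_mono norm_ge_zero norm_mult_ineq order_trans)
  with \<open>R \<ge> 0\<close> \<open>S \<ge> 0\<close> show ?thesis unfolding bounded_range_iff by (meson mult_nonneg_nonneg)
qed

lemma bounded_range_plus:
  fixes f g :: "nat \<Rightarrow> 'a::real_normed_vector"
  assumes "bounded (range f)" "bounded (range g)"
  shows "bounded (range (\<lambda>n. f n + g n))"
  using bounded_plus_comp[OF assms] .

text \<open>Models the 2-norm \<open>\<lambda>a. norm (\<pi> a \<xi>)\<close> on A, with
  \<open>K = 2\<close>. Only left multiplication is bounded by assumption; \<open>nu_star\<close>
  transfers the bound to the right.\<close>

locale two_sided_seminorm =
  fixes \<nu> :: "'a::unital_cstar_algebra \<Rightarrow> real" and K :: real and \<omega> :: "nat filter"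
  assumes nu_nonneg: "0 \<le> \<nu> x"
    and nu_triangle: "\<nu> (x + y) \<le> \<nu> x + \<nu> y"
    and nu_star: "\<nu> (star x) = \<nu> x"
    and nu_mult_left: "\<nu> (x * y) \<le> K * norm x * \<nu> y"
    and K_nonneg: "0 \<le> K"
begin

definition null :: "(nat \<Rightarrow> 'a) set" where
  "null = {z. bounded (range z) \<and> ((\<lambda>n. \<nu> (z n)) \<longlongrightarrow> 0) \<omega>}"

lemma null_plus:
  assumes "x \<in> null" "y \<in> null"
  shows "(\<lambda>n. x n + y n) \<in> null"
proof -
  have "((\<lambda>n. \<nu> (x n) + \<nu> (y n)) \<longlongrightarrow> 0) \<omega>"
    using assms by (auto simp: null_def intro!: tendsto_add_zero)
  then have "((\<lambda>n. \<nu> (x n + y n)) \<longlongrightarrow> 0) \<omega>"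
    by (rule Lim_null_comparison[rotated]) (simp add: nu_nonneg nu_triangle)
  with assms show ?thesis by (auto simp: null_def intro: bounded_range_plus)
qed

lemma null_star:
  assumes "x \<in> null"
  shows "(\<lambda>n. star (x n)) \<in> null"
  using assms by (simp add: null_def nu_star bounded_range_iff)

lemma null_mult_left:
  assumes y: "bounded (range y)" and z: "z \<in> null"
  shows "(\<lambda>n. y n * z n) \<in> null"
proof -
  obtain R where R: "R \<ge> 0" "\<And>n. norm (y n) \<le> R" using y by (auto simp: bounded_range_iff)
  have le: "\<nu> (y n * z n) \<le> K * R * \<nu> (z n)" for n
  proof -
    have "K * norm (y n) * \<nu> (z n) \<le> K * R * \<nu> (z n)"
      by (intro mult_right_mono mult_left_mono R nu_nonneg K_nonneg)
    then show ?thesis using nu_mult_left[of "y n" "z n"] by simp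
  qed
  have "((\<lambda>n. K * R * \<nu> (z n)) \<longlongrightarrow> 0) \<omega>"
    using z by (auto simp: null_def intro!: tendsto_mult_right_zero)
  then have "((\<lambda>n. \<nu> (y n * z n)) \<longlongrightarrow> 0) \<omega>"
    by (rule Lim_null_comparison[rotated]) (simp add: nu_nonneg le)
  then show ?thesis using y z by (simp add: null_def bounded_range_mult)
qed

lemma null_mult_right:
  assumes y: "bounded (range y)" and z: "z \<in> null"
  shows "(\<lambda>n. z n * y n) \<in> null"
proof -
  have "bounded (range (\<lambda>n. star (y n)))" using y by (simp add: bounded_range_iff)
  from null_star[OF null_mult_left[OF this null_star[OF z]]]
  show ?thesis by (simp add: star_mult star_star)
qed

lemma null_const_mult_left: "z \<in> null \<Longrightarrow> (\<lambda>n. y * z n) \<in> null"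
  using null_mult_left[of "\<lambda>_. y"] by simp

lemma null_const_mult_right: "z \<in> null \<Longrightarrow> (\<lambda>n. z n * y) \<in> null"
  using null_mult_right[of "\<lambda>_. y"] by simp

lemma null_zero: "(\<lambda>_. 0) \<in> null"
proof -
  have "\<nu> (0 * 0) \<le> 0" using nu_mult_left[of 0 0] by simp
  then have "\<nu> 0 = 0" using nu_nonneg[of 0] by simp
  then show ?thesis by (simp add: null_def)
qed

lemma null_uminus: "z \<in> null \<Longrightarrow> (\<lambda>n. - z n) \<in> null"
  using null_const_mult_left[of z "-1"] by simp

lemma null_scaleR: "z \<in> null \<Longrightarrow> (\<lambda>n. r *\<^sub>R z n) \<in> null"
  using null_const_mult_left[of z "r *\<^sub>R 1"] by simp

text \<open>With \<open>a = z z\<^sup>* / \<delta>\<^sup>2\<close> the element \<open>q = (1 + a\<^sup>2)\<^sup>-\<^sup>1\<close> works, since \<open>q a\<close> is a contraction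
  and \<open>1 - q = (q a) a\<close>.\<close>

lemma approximate_unit_single:
  assumes z: "z \<in> null" and \<delta>: "\<delta> > 0"
  shows "\<exists>q. (\<lambda>n. 1 - q n) \<in> null \<and> (\<forall>n. norm (q n) \<le> 1 \<and> norm (q n * z n) \<le> \<delta>)"
proof -
  define a where "a n = (1 / \<delta>\<^sup>2) *\<^sub>R (z n * star (z n))" for n
  have sa: "star (a n) = a n" for n by (simp add: a_def star_scaleR star_mult star_star)
  have "\<exists>q. star q = q \<and> q * (1 + a n * a n) = 1 \<and> norm q \<le> 1 \<and> norm (q * a n) \<le> 1" for n
    by (rule one_plus_square_invertible[OF sa[of n]]) blast
  then obtain q where q: "\<And>n. star (q n) = q n" "\<And>n. q n * (1 + a n * a n) = 1"
    "\<And>n. norm (q n) \<le> 1" "\<And>n. norm (q n * a n) \<le> 1"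
    by metis
  have "bounded (range (\<lambda>n. star (z n)))"
    using z by (simp add: null_def bounded_range_iff)
  then have a: "a \<in> null" unfolding a_def by (intro null_scaleR null_mult_right z)
  have "1 - q n = (q n * a n) * a n" for n
    using q(2)[of n] by (simp add: distrib_left mult.assoc diff_eq_eq add.commute)
  moreover have "bounded (range (\<lambda>n. q n * a n))"
    unfolding bounded_range_iff using q(4) by (intro exI[of _ 1]) auto
  ultimately have "(\<lambda>n. 1 - q n) \<in> null" using null_mult_left a by simp
  moreover have "norm (q n * z n) \<le> \<delta>" for n
  proof -
    have "(norm (q n * z n))\<^sup>2 = norm (q n * z n * star (z n) * q n)"
      using cstar_identity[of "star (q n * z n)"] norm_star[of "q n * z n"]
      by (simp add: star_mult star_star q mult.assoc)
    also have "\<dots> = \<delta>\<^sup>2 * norm (q n * a n * q n)" using \<delta> by (simp add: a_def mult.assoc)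
    also have "norm (q n * a n * q n) \<le> 1"
      using norm_mult_ineq[of "q n * a n" "q n"] mult_mono[OF q(4)[of n] q(3)[of n]] by simp
    finally have "(norm (q n * z n))\<^sup>2 \<le> \<delta>\<^sup>2" using \<delta> by (simp add: mult_left_le)
    then show ?thesis using \<delta> by (simp add: power2_le_iff_abs_le)
  qed
  ultimately show ?thesis using q by blast
qed

lemma approximate_unit_finite:
  assumes "finite Z" "Z \<subseteq> null" and \<delta>: "\<delta> > 0"
  shows "\<exists>p. (\<lambda>n. 1 - p n) \<in> null \<and> (\<forall>n. norm (p n) \<le> 1 \<and> (\<forall>z\<in>Z. norm (p n * z n) \<le> \<delta>))"
  using assms(1,2)
proof (induction Z rule: finite_induct)
  case empty
  show ?case by (rule exI[of _ "\<lambda>_. 1"]) (simp add: null_zero)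
next
  case (insert x Z)
  then obtain p where p: "(\<lambda>n. 1 - p n) \<in> null" "\<And>n. norm (p n) \<le> 1"
    "\<And>n z. z \<in> Z \<Longrightarrow> norm (p n * z n) \<le> \<delta>" by auto
  have bp: "bounded (range p)" using p(2) by (auto simp: bounded_range_iff intro!: exI[of _ 1])
  \<comment> \<open>The next unit \<open>q\<close> is chosen for \<open>p * x\<close> rather than
    for \<open>x\<close>, so that the product \<open>q * p\<close> absorbs \<open>x\<close>; as a
    contraction on the left, \<open>q\<close> preserves the bounds already obtained.\<close>
  then have "(\<lambda>n. p n * x n) \<in> null" using insert.prems by (intro null_mult_left) auto
  then obtain q where q: "(\<lambda>n. 1 - q n) \<in> null" "\<And>n. norm (q n) \<le> 1"
    "\<And>n. norm (q n * (p n * x n)) \<le> \<delta>" using approximate_unit_single[OF _ \<delta>] by blast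
  have contract: "norm (q n * y) \<le> norm y" for n y
    using norm_mult_ineq[of "q n" y] q(2)[of n] mult_left_le_one_le[of "norm y" "norm (q n)"] by simp
  show ?case
  proof (intro exI[of _ "\<lambda>n. q n * p n"] conjI allI ballI)
    have "(\<lambda>n. (1 - q n) * p n + (1 - p n)) \<in> null"
      by (intro null_plus null_mult_right p q bp)
    then show "(\<lambda>n. 1 - q n * p n) \<in> null" by (simp add: left_diff_distrib)
    show "norm (q n * p n) \<le> 1" for n using contract[of n "p n"] p(2)[of n] by simp
    show "norm (q n * p n * z n) \<le> \<delta>" if "z \<in> insert x Z" for n z
    proof (cases "z = x")
      case True then show ?thesis using q(3) by (simp add: mult.assoc)
    next
      case False
      then show ?thesis using that contract[of n "p n * z n"] p(3)[of z n] by (simp add: mult.assoc)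
    qed
  qed
qed

text \<open>Replace \<open>p\<close> by \<open>star p * p\<close>: the extra contraction on the left
  preserves the bounds on \<open>p * z\<close>.\<close>

lemma approximate_unit_selfadjoint:
  assumes "finite Z" "Z \<subseteq> null" and \<delta>: "\<delta> > 0"
  shows "\<exists>p. (\<lambda>n. 1 - p n) \<in> null \<and>
    (\<forall>n. star (p n) = p n \<and> norm (p n) \<le> 1 \<and> (\<forall>z\<in>Z. norm (p n * z n) \<le> \<delta>))"
proof -
  obtain p where p: "(\<lambda>n. 1 - p n) \<in> null" "\<And>n. norm (p n) \<le> 1"
    "\<And>n z. z \<in> Z \<Longrightarrow> norm (p n * z n) \<le> \<delta>"
    using approximate_unit_finite[OF assms] by blast
  have bp: "bounded (range (\<lambda>n. star (p n)))"
    using p(2) by (auto simp: bounded_range_iff intro!: exI[of _ 1])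
  show ?thesis
  proof (intro exI[of _ "\<lambda>n. star (p n) * p n"] conjI allI ballI)
    have "(\<lambda>n. star (1 - p n) + star (p n) * (1 - p n)) \<in> null"
      by (intro null_plus null_mult_left null_star p bp)
    then show "(\<lambda>n. 1 - star (p n) * p n) \<in> null" by (simp add: star_diff right_diff_distrib)
    show "star (star (p n) * p n) = star (p n) * p n" for n by (simp add: star_mult star_star)
    show "norm (star (p n) * p n) \<le> 1" for n
      using p(2)[of n] by (simp add: cstar_identity power_le_one)
    show "norm (star (p n) * p n * z n) \<le> \<delta>" if "z \<in> Z" for n z
      using norm_mult_ineq[of "star (p n)" "p n * z n"] p(2)[of n] p(3)[OF that, of n]
        mult_left_le_one_le[of "norm (p n * z n)" "norm (p n)"]
      by (simp add: mult.assoc)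
  qed
qed

text \<open>The commutators \<open>[f\<^sub>l, b]\<close> of the summands of \<open>F\<close> are almost orthogonal, hence \<open>\<parallel>[F, b]\<parallel>\<close>
  grows only like the square root of the number of summands.\<close>

lemma quasicentral_sum:
  assumes B: "finite B" and C: "finite C" "C \<subseteq> null" and \<delta>: "\<delta> > 0"
  shows "\<exists>F. F \<in> null \<and> (\<forall>n. star (F n) = F n \<and> norm (of_nat L - F n) \<le> real L \<and>
    (\<forall>b\<in>B. (norm (F n * b - b * F n))\<^sup>2 \<le> real L * (4 * (norm b)\<^sup>2 + 1)) \<and>
    (\<forall>c\<in>C. norm ((of_nat L - F n) * c n) \<le> real L * \<delta>))"
proof (induction L)
  case 0
  show ?case by (rule exI[of _ "\<lambda>_. 0"]) (simp add: null_zero)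
next
  case (Suc L)
  then obtain F where F: "F \<in> null" "\<And>n. star (F n) = F n" "\<And>n. norm (of_nat L - F n) \<le> real L"
    "\<And>n b. b \<in> B \<Longrightarrow> (norm (F n * b - b * F n))\<^sup>2 \<le> real L * (4 * (norm b)\<^sup>2 + 1)"
    "\<And>n c. c \<in> C \<Longrightarrow> norm ((of_nat L - F n) * c n) \<le> real L * \<delta>"
    by blast
  define \<beta> where "\<beta> = (\<Sum>b\<in>B. norm b)"
  have \<beta>: "norm b \<le> \<beta>" if "b \<in> B" for b
    unfolding \<beta>_def using that B by (intro member_le_sum) auto
  have \<beta>0: "0 \<le> \<beta>" unfolding \<beta>_def by (simp add: sum_nonneg)
  \<comment> \<open>The cross term \<open>star T * t\<close> below splits into four products of
    norms at most \<eta>, \<beta>^2 \<eta>, \<eta> and \<beta> \<eta>. Their sum is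
    \<open>\<eta> * D\<close>, and \<eta> is chosen to make it at most 1/2.\<close>
  define D where "D = 2 + \<beta> + \<beta> * \<beta>"
  have D: "0 < D" using \<beta>0 by (simp add: D_def add_pos_nonneg)
  define \<eta> where "\<eta> = min \<delta> (1 / (2 * D))"
  have \<eta>: "0 < \<eta>" "\<eta> \<le> \<delta>" using \<delta> D by (auto simp: \<eta>_def)
  have "\<eta> * D \<le> 1 / (2 * D) * D" using D by (intro mult_right_mono) (auto simp: \<eta>_def)
  then have \<eta>2: "\<eta> * D \<le> 1/2" using D by simp
  \<comment> \<open>Besides \<open>C\<close>, the new unit has to absorb the factors that stand next
    to \<open>p\<close> in the expansion of \<open>star T * t\<close>, up to adjoints.\<close>
  define Z where "Z = C \<union> {F} \<union> (\<lambda>b n. star b * F n * b) ` B \<union> (\<lambda>b n. star b * b * F n) ` B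
    \<union> (\<lambda>b n. b * F n) ` B"
  have "finite Z" using B C by (simp add: Z_def)
  moreover have "Z \<subseteq> null"
  proof -
    have "(\<lambda>n. star b * F n * b) \<in> null" "(\<lambda>n. star b * b * F n) \<in> null" "(\<lambda>n. b * F n) \<in> null" for b
      by (intro null_const_mult_left null_const_mult_right F)+
    then show ?thesis using C(2) F(1) unfolding Z_def by blast
  qed
  ultimately obtain p where p0: "(\<lambda>n. 1 - p n) \<in> null"
    "\<forall>n. star (p n) = p n \<and> norm (p n) \<le> 1 \<and> (\<forall>z\<in>Z. norm (p n * z n) \<le> \<eta>)"
    using approximate_unit_selfadjoint[OF _ _ \<eta>(1), of Z] by blast
  then have p: "(\<lambda>n. 1 - p n) \<in> null" "star (p n) = p n" "norm (p n) \<le> 1"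
    and pz: "z \<in> Z \<Longrightarrow> norm (p n * z n) \<le> \<eta>" for n z by blast+
  have eq: "of_nat (Suc L) - (F n + (1 - p n)) = (of_nat L - F n) + p n" for n
    by simp
  show ?case
  proof (intro exI[of _ "\<lambda>n. F n + (1 - p n)"] conjI allI ballI)
    show "(\<lambda>n. F n + (1 - p n)) \<in> null" by (intro null_plus F p)
    fix n
    show "star (F n + (1 - p n)) = F n + (1 - p n)" by (simp add: star_add star_diff F p)
    show "norm (of_nat (Suc L) - (F n + (1 - p n))) \<le> real (Suc L)"
      unfolding eq using norm_triangle_ineq[of "of_nat L - F n" "p n"] F(3)[of n] p(3)[of n] by simp
    show "norm ((of_nat (Suc L) - (F n + (1 - p n))) * c n) \<le> real (Suc L) * \<delta>" if "c \<in> C" for c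
    proof -
      have "norm ((of_nat (Suc L) - (F n + (1 - p n))) * c n)
          \<le> norm ((of_nat L - F n) * c n) + norm (p n * c n)"
        unfolding eq distrib_right by (rule norm_triangle_ineq)
      also have "\<dots> \<le> real L * \<delta> + \<delta>"
        using F(5)[OF that, of n] pz[of c n] that \<eta> by (intro add_mono) (auto simp: Z_def)
      finally show ?thesis by (simp add: algebra_simps)
    qed
    fix b assume b: "b \<in> B"
    \<comment> \<open>\<open>T\<close> is the commutator of the old sum with \<open>b\<close>, and
      \<open>t\<close> is the contribution of the new summand \<open>1 - p n\<close>.\<close>
    define T where "T = F n * b - b * F n"
    define t where "t = b * p n - p n * b"
    \<comment> \<open>\<open>p n\<close> absorbs from the left; as it is selfadjoint, taking
      adjoints moves it to the right end, where the expansion needs it.\<close>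
    have flip: "norm (x * p n) = norm (p n * star x)" for x
      by (metis norm_star p(2) star_mult)
    have z: "norm (star b * F n * b * p n) \<le> \<eta>" "norm (F n * p n) \<le> \<eta>"
      "norm (F n * star b * b * p n) \<le> \<eta>" "norm (F n * star b * p n) \<le> \<eta>"
      using pz[of "\<lambda>n. star b * F n * b" n] pz[of F n] pz[of "\<lambda>n. star b * b * F n" n]
        pz[of "\<lambda>n. b * F n" n] b
      unfolding flip by (auto simp: Z_def star_mult star_star F(2) mult.assoc)
    have "star T * t = star b * F n * b * p n - star b * (F n * p n) * b
        - F n * star b * b * p n + F n * star b * p n * b"
      by (simp add: T_def t_def star_diff star_mult F algebra_simps)
    also have "norm \<dots> \<le> \<eta> + \<beta> * \<eta> * \<beta> + \<eta> + \<eta> * \<beta>"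
    proof (intro norm_triangle_le norm_triangle_le_diff add_mono z)
      have "norm (star b * (F n * p n) * b) \<le> norm (star b) * norm (F n * p n) * norm b"
        by (meson mult_right_mono norm_ge_zero norm_mult_ineq order_trans)
      also have "\<dots> \<le> \<beta> * \<eta> * \<beta>"
        using \<beta>[OF b] z(2) \<beta>0 \<eta>(1) by (intro mult_mono) auto
      finally show "norm (star b * (F n * p n) * b) \<le> \<beta> * \<eta> * \<beta>" .
      have "norm (F n * star b * p n * b) \<le> norm (F n * star b * p n) * norm b"
        by (rule norm_mult_ineq)
      also have "\<dots> \<le> \<eta> * \<beta>" using \<beta>[OF b] z(4) \<eta>(1) by (intro mult_mono) auto
      finally show "norm (F n * star b * p n * b) \<le> \<eta> * \<beta>" .
    qed
    also have "\<dots> \<le> 1/2" using \<eta>2 by (simp add: D_def algebra_simps)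
    finally have Tt: "norm (star T * t) \<le> 1/2" .
    have tT: "norm (star t * T) \<le> 1/2"
      using Tt norm_star[of "star T * t"] by (simp add: star_mult star_star)
    have nt: "norm t \<le> 2 * norm b"
    proof -
      have "norm (b * p n) \<le> norm b" "norm (p n * b) \<le> norm b"
        using norm_mult_ineq[of b "p n"] norm_mult_ineq[of "p n" b] p(3)[of n]
          mult_left_le_one_le[of "norm b" "norm (p n)"] by (simp_all add: mult.commute)
      then show ?thesis using norm_triangle_ineq4[of "b * p n" "p n * b"] by (simp add: t_def)
    qed
    \<comment> \<open>By the C*-identity the squares add up to two cross terms of at most 1/2 each.
      This is the \<open>+ 1\<close> in the growth rate; the 4 comes from
      \<open>norm t \<le> 2 * norm b\<close>.\<close>
    have "(norm (T + t))\<^sup>2 = norm (star (T + t) * (T + t))" by (simp add: cstar_identity)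
    also have "star (T + t) * (T + t) = star T * T + star t * t + (star T * t + star t * T)"
      by (simp add: star_add algebra_simps)
    also have "norm \<dots> \<le> (norm T)\<^sup>2 + (norm t)\<^sup>2 + (1/2 + 1/2)"
      by (intro norm_triangle_le add_mono Tt tT) (simp_all add: cstar_identity)
    also have "\<dots> \<le> real L * (4 * (norm b)\<^sup>2 + 1) + (2 * norm b)\<^sup>2 + (1/2 + 1/2)"
      using F(4)[OF b, of n] nt by (intro add_mono power_mono) (auto simp: T_def)
    finally have "(norm (T + t))\<^sup>2 \<le> real (Suc L) * (4 * (norm b)\<^sup>2 + 1)"
      by (simp add: algebra_simps power_mult_distrib)
    moreover have "(F n + (1 - p n)) * b - b * (F n + (1 - p n)) = T + t"
      by (simp add: T_def t_def algebra_simps)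
    ultimately show "(norm ((F n + (1 - p n)) * b - b * (F n + (1 - p n))))\<^sup>2
        \<le> real (Suc L) * (4 * (norm b)\<^sup>2 + 1)" by simp
  qed
qed

lemma quasicentral_unit:
  assumes B: "finite B" and C: "finite C" "C \<subseteq> null" and \<epsilon>: "\<epsilon> > 0"
  shows "\<exists>p. (\<lambda>n. 1 - p n) \<in> null \<and> (\<forall>n. norm (p n) \<le> 1 \<and>
    (\<forall>b\<in>B. norm (p n * b - b * p n) \<le> \<epsilon>) \<and> (\<forall>c\<in>C. norm (p n * c n) \<le> \<epsilon>))"
proof -
  define \<beta> where "\<beta> = (\<Sum>b\<in>B. 4 * (norm b)\<^sup>2 + 1)"
  have \<beta>: "4 * (norm b)\<^sup>2 + 1 \<le> \<beta>" if "b \<in> B" for b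
    unfolding \<beta>_def using that B
    by (intro member_le_sum[of _ _ "\<lambda>b. 4 * (norm b)\<^sup>2 + 1"]) auto
  \<comment> \<open>The commutators of \<open>F\<close> have norm at most sqrt (L \<beta>), so after
    division by L the square is at most \<beta> / L; L brings this down to \<epsilon>^2.\<close>
  obtain L0 :: nat where L0: "\<beta> / \<epsilon>\<^sup>2 < real L0" using reals_Archimedean2 by blast
  define L where "L = Suc L0"
  have L: "0 < real L" "\<beta> \<le> real L * \<epsilon>\<^sup>2"
  proof -
    have "\<beta> / \<epsilon>\<^sup>2 \<le> real L" using L0 by (simp add: L_def)
    then show "\<beta> \<le> real L * \<epsilon>\<^sup>2" using \<epsilon> by (simp add: pos_divide_le_eq)
  qed (simp add: L_def)
  obtain F where F: "F \<in> null" "\<And>n. norm (of_nat L - F n) \<le> real L"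
    "\<And>n b. b \<in> B \<Longrightarrow> (norm (F n * b - b * F n))\<^sup>2 \<le> real L * (4 * (norm b)\<^sup>2 + 1)"
    "\<And>n c. c \<in> C \<Longrightarrow> norm ((of_nat L - F n) * c n) \<le> real L * \<epsilon>"
    using quasicentral_sum[OF B C \<epsilon>, of L] by blast
  define p where "p n = (1 / real L) *\<^sub>R (of_nat L - F n)" for n
  have one: "1 - p n = (1 / real L) *\<^sub>R F n" for n
  proof -
    have "(of_nat L :: 'a) = real L *\<^sub>R 1" by (simp add: scaleR_conv_of_real)
    then show ?thesis using L(1) by (simp add: p_def scaleR_diff_right)
  qed
  show ?thesis
  proof (intro exI[of _ p] conjI allI ballI)
    show "(\<lambda>n. 1 - p n) \<in> null" unfolding one by (intro null_scaleR F)
    fix n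
    show "norm (p n) \<le> 1" using F(2)[of n] L(1) by (simp add: p_def divide_simps)
    show "norm (p n * c n) \<le> \<epsilon>" if "c \<in> C" for c
      using F(4)[OF that, of n] L(1) by (simp add: p_def divide_simps mult.commute)
    fix b assume b: "b \<in> B"
    have "p n * b - b * p n = - ((1 - p n) * b - b * (1 - p n))" by (simp add: algebra_simps)
    also have "\<dots> = - ((1 / real L) *\<^sub>R (F n * b - b * F n))"
      unfolding one by (simp add: scaleR_diff_right)
    finally have "real L * norm (p n * b - b * p n) = norm (F n * b - b * F n)"
      using L(1) by simp
    then have "(real L * norm (p n * b - b * p n))\<^sup>2 \<le> real L * \<beta>"
      using F(3)[OF b, of n] mult_left_mono[OF \<beta>[OF b], of "real L"] by simp
    also have "\<dots> \<le> real L * (real L * \<epsilon>\<^sup>2)" using L by (intro mult_left_mono) auto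
    also have "\<dots> = (real L * \<epsilon>)\<^sup>2" by (simp add: power2_eq_square)
    finally show "norm (p n * b - b * p n) \<le> \<epsilon>"
      using L \<epsilon> by (simp add: power2_le_iff_abs_le)
  qed
qed

text \<open>Countably many conditions are met along a diagonal sequence: \<open>k n\<close> is the largest
  \<open>m \<le> n\<close> for which the \<open>m\<close>-th unit is already \<open>\<nu>\<close>-close to \<open>1\<close> at \<open>n\<close>.\<close>

lemma central_lift:
  fixes b :: "nat \<Rightarrow> 'a"
  assumes \<omega>: "\<omega> \<le> sequentially" and a: "bounded (range a)"
    and ab: "\<And>j. (\<lambda>n. a n * b j - b j * a n) \<in> null"
  shows "\<exists>a'. bounded (range a') \<and> (\<lambda>n. a' n - a n) \<in> null \<and>
    (\<forall>j. ((\<lambda>n. norm (a' n * b j - b j * a' n)) \<longlongrightarrow> 0) \<omega>)"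
proof -
  define P where "P m p \<longleftrightarrow> (\<lambda>n. 1 - p n) \<in> null \<and> (\<forall>n. norm (p n) \<le> 1 \<and>
      (\<forall>x\<in>b ` {..m}. norm (p n * x - x * p n) \<le> 1 / real (Suc m)) \<and>
      (\<forall>c\<in>(\<lambda>j n. a n * b j - b j * a n) ` {..m}. norm (p n * c n) \<le> 1 / real (Suc m)))"
    for m p
  have "\<exists>p. P m p" for m
    unfolding P_def by (rule quasicentral_unit) (use ab in auto)
  then obtain p where pP: "\<And>m. P m (p m)" by metis
  have p: "(\<lambda>n. 1 - p m n) \<in> null" "norm (p m n) \<le> 1"
    "j \<le> m \<Longrightarrow> norm (p m n * b j - b j * p m n) \<le> 1 / real (Suc m)"
    "j \<le> m \<Longrightarrow> norm (p m n * (a n * b j - b j * a n)) \<le> 1 / real (Suc m)" for m n j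
    using pP[of m] by (auto simp: P_def)
  define S where "S n = {m. m \<le> n \<and> \<nu> (1 - p m n) < 1 / real (Suc m)}" for n
  have fin: "finite (S n)" for n by (rule finite_subset[of _ "{..n}"]) (auto simp: S_def)
  \<comment> \<open>\<open>S n\<close> may be empty, and then \<open>k n\<close> is an unspecified
    number; along \<omega> this eventually does not happen. The bound on \<open>norm (q n)\<close>
    holds there too, since it is valid for every index of \<open>p\<close>.\<close>
  define k where "k n = Max (S n)" for n
  have k: "eventually (\<lambda>n. k n \<in> S n \<and> M \<le> k n) \<omega>" for M
  proof -
    have "eventually (\<lambda>n. \<nu> (1 - p M n) < 1 / real (Suc M)) \<omega>"
      using p(1)[of M] by (intro order_tendstoD(2)[of _ 0]) (auto simp: null_def)
    moreover have "eventually (\<lambda>n. M \<le> n) \<omega>"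
      using \<omega> by (rule filter_leD) (rule eventually_ge_at_top)
    ultimately show ?thesis
    proof eventually_elim
      case (elim n)
      then have M: "M \<in> S n" by (simp add: S_def)
      then have "Max (S n) \<in> S n" using fin[of n] by (intro Max_in) auto
      then show ?case using M fin[of n] by (simp add: k_def)
    qed
  qed
  have small: "eventually (\<lambda>n. k n \<in> S n \<and> M \<le> k n \<and> c / real (Suc (k n)) < e) \<omega>"
    if "0 < e" "0 \<le> c" for M c e
  proof -
    obtain M' :: nat where M': "c / e < real M'" using reals_Archimedean2 by blast
    show ?thesis
      using k[of "max M M'"]
    proof eventually_elim
      case (elim n)
      then have "c / e < real (Suc (k n))" using M' by auto
      then show ?case using elim that by (simp add: field_simps)
    qed
  qed
  define q where "q n = p (k n) n" for n
  define a' where "a' n = q n * a n" for n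
  have q: "(\<lambda>n. 1 - q n) \<in> null"
    unfolding null_def
  proof (intro CollectI conjI)
    show "bounded (range (\<lambda>n. 1 - q n))"
      unfolding bounded_range_iff
    proof (intro exI[of _ 2] conjI allI)
      show "norm (1 - q n) \<le> 2" for n
        using norm_triangle_ineq4[of 1 "q n"] p(2)[of "k n" n] by (simp add: q_def)
    qed simp
    show "((\<lambda>n. \<nu> (1 - q n)) \<longlongrightarrow> 0) \<omega>"
    proof (rule tendstoI)
      fix e :: real assume "0 < e"
      show "eventually (\<lambda>n. dist (\<nu> (1 - q n)) 0 < e) \<omega>"
        using small[OF \<open>0 < e\<close> zero_le_one, of 0]
        by eventually_elim (auto simp: S_def q_def nu_nonneg)
    qed
  qed
  have bq: "bounded (range q)"
    using p(2) by (auto simp: bounded_range_iff q_def intro!: exI[of _ 1])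
  show ?thesis
  proof (intro exI[of _ a'] conjI allI)
    show "bounded (range a')" unfolding a'_def by (intro bounded_range_mult bq a)
    show "(\<lambda>n. a' n - a n) \<in> null"
      using null_uminus[OF null_mult_right[OF a q]] by (simp add: a'_def left_diff_distrib)
    fix j
    obtain R where R: "R \<ge> 0" "\<And>n. norm (a n) \<le> R" using a by (auto simp: bounded_range_iff)
    show "((\<lambda>n. norm (a' n * b j - b j * a' n)) \<longlongrightarrow> 0) \<omega>"
    proof (rule tendstoI)
      fix e :: real assume "0 < e"
      show "eventually (\<lambda>n. dist (norm (a' n * b j - b j * a' n)) 0 < e) \<omega>"
        using small[OF \<open>0 < e\<close> add_nonneg_nonneg[OF zero_le_one R(1)], of j]
      proof eventually_elim
        case (elim n)
        \<comment> \<open>Leibniz rule for commutators: \<open>q\<close> absorbs the commutator of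
          \<open>a\<close> with \<open>b j\<close>, and it almost commutes with \<open>b j\<close>
          while \<open>a\<close> is bounded.\<close>
        have "a' n * b j - b j * a' n = q n * (a n * b j - b j * a n) + (q n * b j - b j * q n) * a n"
          by (simp add: a'_def algebra_simps)
        also have "norm \<dots> \<le> 1 / real (Suc (k n)) + 1 / real (Suc (k n)) * R"
        proof (intro norm_triangle_le add_mono)
          show "norm (q n * (a n * b j - b j * a n)) \<le> 1 / real (Suc (k n))"
            using p(4)[of j "k n" n] elim unfolding q_def by blast
          have "norm (q n * b j - b j * q n) \<le> 1 / real (Suc (k n))"
            using p(3)[of j "k n" n] elim unfolding q_def by blast
          then show "norm ((q n * b j - b j * q n) * a n) \<le> 1 / real (Suc (k n)) * R"
            using R by (intro order_trans[OF norm_mult_ineq] mult_mono) auto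
        qed
        also have "\<dots> = (1 + R) / real (Suc (k n))" by (simp add: add_divide_distrib)
        finally show ?case using elim by simp
      qed
    qed
  qed
qed

end

section \<open>Adjoints on complex Hilbert spaces\<close>

lemma cinner_add_right: "cinner x (y + z) = cinner x y + cinner x (z::'h::complex_hilbert_space)"
  by (metis cinner_add_left cinner_commute complex_cnj_add)

lemma cinner_cscale_right: "cinner x (c *\<^sub>C y) = cnj c * cinner x (y::'h::complex_hilbert_space)"
  by (metis cinner_cscale_left cinner_commute complex_cnj_mult)

lemma inner_cscale_left: "(c *\<^sub>C x) \<bullet> y = x \<bullet> (cnj c *\<^sub>C (y::'h::complex_hilbert_space))"
  by (simp flip: Re_cinner add: cinner_cscale_left cinner_cscale_right)

lemma cinner_eq_inner:
  "cinner x y = complex_of_real (x \<bullet> y) + \<i> * complex_of_real (x \<bullet> (\<i> *\<^sub>C (y::'h::complex_hilbert_space)))"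
  by (rule complex_eqI) (simp_all flip: Re_cinner add: cinner_cscale_right)

lemma cinner_self: "Re (cinner x x) = (norm (x::'h::complex_hilbert_space))\<^sup>2"
  by (simp add: Re_cinner power2_norm_eq_inner)

text \<open>Minimize the quadratic functional \<open>J\<close>: the parallelogram law makes a
  minimizing sequence Cauchy, and the first variation vanishes at its limit.\<close>

lemma riesz_representation:
  fixes f :: "'h::{real_inner, complete_space} \<Rightarrow> real"
  assumes "bounded_linear f"
  shows "\<exists>y. \<forall>x. f x = x \<bullet> y"
proof -
  interpret f: bounded_linear f by fact
  obtain K where K: "\<And>x. norm (f x) \<le> norm x * K" using f.bounded by blast
  define J where "J y = (norm y)\<^sup>2 - 2 * f y" for y
  define m where "m = (INF y. J y)"
  have "- (K\<^sup>2) \<le> J y" for y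
  proof -
    have "0 \<le> (norm y - K)\<^sup>2" by simp
    then show ?thesis using K[of y] by (simp add: J_def power2_eq_square algebra_simps abs_le_iff)
  qed
  then have bdd: "bdd_below (range J)" by (auto intro!: bdd_belowI)
  then have m: "m \<le> J y" for y unfolding m_def by (rule cINF_lower) simp
  have "\<exists>y. J y < m + 1 / real (Suc n)" for n
    using cINF_less_iff[of UNIV J "m + 1 / real (Suc n)"] bdd by (auto simp: m_def)
  then obtain y where y: "\<And>n. J (y n) < m + 1 / real (Suc n)" by metis
  have par: "(norm (u - v))\<^sup>2 \<le> 2 * (J u - m) + 2 * (J v - m)" for u v
  proof -
    have "(norm (u - v))\<^sup>2 = 2 * J u + 2 * J v - 4 * J ((1/2) *\<^sub>R (u + v))"
      by (simp add: J_def f.scaleR f.add power2_norm_eq_inner algebra_simps inner_commute)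
    then show ?thesis using m[of "(1/2) *\<^sub>R (u + v)"] by simp
  qed
  have "Cauchy y"
  proof (rule metric_CauchyI)
    fix e :: real assume e: "0 < e"
    obtain M :: nat where M: "4 / e\<^sup>2 < real M" using reals_Archimedean2 by blast
    have "dist (y i) (y j) < e" if "i \<ge> M" "j \<ge> M" for i j
    proof -
      have *: "J (y k) - m < e\<^sup>2 / 4" if "k \<ge> M" for k
      proof -
        have "4 / e\<^sup>2 < real (Suc k)" using M that by simp
        then have "1 / real (Suc k) < e\<^sup>2 / 4" using e by (simp add: field_simps)
        then show ?thesis using y[of k] by simp
      qed
      have "(norm (y i - y j))\<^sup>2 < e\<^sup>2"
        using par[of "y i" "y j"] *[OF that(1)] *[OF that(2)] by simp
      then show ?thesis using e by (simp add: dist_norm power2_less_imp_less)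
    qed
    then show "\<exists>M. \<forall>i\<ge>M. \<forall>j\<ge>M. dist (y i) (y j) < e" by blast
  qed
  then obtain z where z: "y \<longlonglongrightarrow> z" using Cauchy_convergent_iff convergent_def by blast
  have "(\<lambda>n. J (y n)) \<longlonglongrightarrow> J z"
    unfolding J_def by (intro tendsto_intros f.tendsto z)
  moreover have "(\<lambda>n. m + 1 / real (Suc n)) \<longlonglongrightarrow> m + 0"
    by (intro tendsto_add tendsto_const LIMSEQ_Suc lim_1_over_n)
  ultimately have Jz: "J z \<le> m"
    using y by (intro LIMSEQ_le[of "\<lambda>n. J (y n)" "J z" "\<lambda>n. m + 1 / real (Suc n)" m]) (auto intro: less_imp_le)
  have "f x = x \<bullet> z" for x
  proof (rule ccontr)
    assume ne: "f x \<noteq> x \<bullet> z"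
    define d where "d = f x - x \<bullet> z"
    have d: "d \<noteq> 0" using ne by (simp add: d_def)
    \<comment> \<open>Nearly the optimal step \<open>d / (norm x)\<^sup>2\<close> in direction
      \<open>x\<close>; the added 1 avoids a zero denominator.\<close>
    define t where "t = d / ((norm x)\<^sup>2 + 1)"
    have pos: "(norm x)\<^sup>2 + 1 > 0" by (simp add: add_nonneg_pos)
    have "J (z + t *\<^sub>R x) = J z + t\<^sup>2 * (norm x)\<^sup>2 - 2 * t * d"
      unfolding J_def d_def power2_norm_eq_inner
      by (simp add: f.add f.scaleR algebra_simps inner_commute power2_eq_square)
    then have "2 * t * d \<le> t\<^sup>2 * (norm x)\<^sup>2" using m[of "z + t *\<^sub>R x"] Jz by simp
    also have "\<dots> \<le> t\<^sup>2 * ((norm x)\<^sup>2 + 1)" by (intro mult_left_mono) auto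
    also have "\<dots> = t * d" using pos by (simp add: t_def power2_eq_square)
    finally have "t * d \<le> 0" by (simp add: mult.commute)
    moreover have "t * d > 0" using d pos by (simp add: t_def zero_less_divide_iff mult_pos_pos flip: power2_eq_square)
    ultimately show False by simp
  qed
  then show ?thesis by blast
qed

lemma mem_bounded_ops:
  "T \<in> carrier bounded_ops \<longleftrightarrow> (\<forall>c x. blinfun_apply T (c *\<^sub>C x) = c *\<^sub>C blinfun_apply T x)"
  by (simp add: bounded_ops_def)

text \<open>Real Riesz representation yields \<open>S\<close> for the real inner product. It
  inherits complex linearity from \<open>T\<close>, and the identity extends to
  \<open>cinner\<close> because the imaginary part is a real inner product with \<i> moved onto the
  second vector.\<close>

lemma adjoint_exists:
  fixes T :: "'h::complex_hilbert_space \<Rightarrow>\<^sub>L 'h"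
  assumes T: "T \<in> carrier bounded_ops"
  shows "\<exists>S\<in>carrier bounded_ops. \<forall>x y. cinner (T x) y = cinner x (blinfun_apply S y)"
proof -
  have "\<exists>z. \<forall>x. T x \<bullet> y = x \<bullet> z" for y
    by (rule riesz_representation)
       (intro bounded_linear_compose[OF bounded_linear_inner_left] blinfun.bounded_linear_right)
  then obtain S where S: "\<And>x y. T x \<bullet> y = x \<bullet> S y" by metis
  have add: "S (u + v) = S u + S v" for u v
    by (subst vector_eq_ldot[symmetric]) (simp add: inner_add_right flip: S)
  have cs: "S (c *\<^sub>C u) = c *\<^sub>C S u" for c u
  proof (subst vector_eq_ldot[symmetric], rule allI)
    fix x
    have "x \<bullet> S (c *\<^sub>C u) = (cnj c *\<^sub>C T x) \<bullet> u" by (simp add: inner_cscale_left flip: S)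
    also have "\<dots> = x \<bullet> (c *\<^sub>C S u)"
      by (metis S T complex_cnj_cnj inner_cscale_left mem_bounded_ops)
    finally show "x \<bullet> S (c *\<^sub>C u) = x \<bullet> (c *\<^sub>C S u)" .
  qed
  have nrm: "norm (S u) \<le> norm u * norm T" for u
  proof (cases "S u = 0")
    case False
    have "norm (S u) * norm (S u) = T (S u) \<bullet> u" by (simp add: S flip: power2_eq_square power2_norm_eq_inner)
    also have "\<dots> \<le> norm (T (S u)) * norm u" by (rule norm_cauchy_schwarz)
    also have "\<dots> \<le> norm T * norm (S u) * norm u" by (intro mult_right_mono norm_blinfun) auto
    finally show ?thesis using False by (simp add: mult.commute)
  qed simp
  have "bounded_linear S"
    by (rule bounded_linear_intro[OF add _ nrm]) (simp add: cs scaleR_cscale)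
  then have app: "blinfun_apply (Blinfun S) = S" by (rule bounded_linear_Blinfun_apply)
  have "cinner (T x) y = cinner x (S y)" for x y
    by (simp add: cinner_eq_inner S cs)
  then show ?thesis using cs by (intro bexI[of _ "Blinfun S"]) (simp_all add: app mem_bounded_ops)
qed

lemma op_adjoint_unique:
  fixes T :: "'h::complex_hilbert_space \<Rightarrow>\<^sub>L 'h"
  assumes S: "\<And>x y. cinner (T x) y = cinner x (blinfun_apply S y)"
  shows "op_adjoint T = S"
  unfolding op_adjoint_def
proof (rule the_equality)
  show "\<forall>x y. cinner (T x) y = cinner x (blinfun_apply S y)" using S by blast
next
  fix R :: "'h \<Rightarrow>\<^sub>L 'h" assume R: "\<forall>x y. cinner (T x) y = cinner x (blinfun_apply R y)"
  have "R y = S y" for y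
    by (subst vector_eq_ldot[symmetric]) (simp flip: Re_cinner S add: R[rule_format, symmetric])
  then show "R = S" by (rule blinfun_eqI)
qed

lemma op_adjoint:
  fixes T :: "'h::complex_hilbert_space \<Rightarrow>\<^sub>L 'h"
  assumes T: "T \<in> carrier bounded_ops"
  shows op_adjoint_closed: "op_adjoint T \<in> carrier bounded_ops"
    and cinner_op_adjoint: "cinner (T x) y = cinner x (op_adjoint T y)"
proof -
  obtain S where S: "S \<in> carrier bounded_ops" "\<And>x y. cinner (T x) y = cinner x (blinfun_apply S y)"
    using adjoint_exists[OF T] by blast
  have "op_adjoint T = S" by (rule op_adjoint_unique) (rule S)
  with S show "op_adjoint T \<in> carrier bounded_ops" "cinner (T x) y = cinner x (op_adjoint T y)" by simp_all
qed

lemma cinner_op_adjoint':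
  assumes T: "T \<in> carrier bounded_ops"
  shows "cinner (op_adjoint T x) y = cinner x (T y)"
  by (metis cinner_op_adjoint[OF T] cinner_commute)

lemma norm_op_adjoint_apply:
  assumes T: "T \<in> carrier bounded_ops"
  shows "norm (op_adjoint T v) \<le> norm T * norm v"
proof (cases "op_adjoint T v = 0")
  case False
  let ?w = "op_adjoint T v"
  have "norm ?w * norm ?w = Re (cinner (T ?w) v)"
    by (simp add: cinner_op_adjoint[OF T] cinner_self power2_eq_square)
  also have "\<dots> \<le> norm (T ?w) * norm v" by (simp add: Re_cinner norm_cauchy_schwarz)
  also have "\<dots> \<le> norm T * norm ?w * norm v" by (intro mult_right_mono norm_blinfun) auto
  finally show ?thesis using False by (simp add: mult.commute)
qed simp

lemma norm_op_adjoint_le: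
  assumes "T \<in> carrier bounded_ops"
  shows "norm (op_adjoint T) \<le> norm T"
  by (rule norm_blinfun_bound) (simp_all add: norm_op_adjoint_apply[OF assms])

lemma two_norm_eq:
  assumes "T \<in> carrier bounded_ops"
  shows "two_norm \<xi> T = norm (T \<xi>)"
  by (simp add: two_norm_def gns_trace_def cinner_op_adjoint'[OF assms] cinner_self)

lemma bounded_ops_plus:
  "S \<in> carrier bounded_ops \<Longrightarrow> T \<in> carrier bounded_ops \<Longrightarrow> S + T \<in> carrier bounded_ops"
  by (simp add: mem_bounded_ops blinfun.bilinear_simps cscale_add_right)

lemma bounded_ops_compose:
  "S \<in> carrier bounded_ops \<Longrightarrow> T \<in> carrier bounded_ops \<Longrightarrow> S o\<^sub>L T \<in> carrier bounded_ops"
  by (simp add: mem_bounded_ops)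

lemma blinfun_cscale_apply [simp]: "blinfun_cscale c T x = c *\<^sub>C T x"
  by transfer simp

lemma bounded_ops_cscale: "T \<in> carrier bounded_ops \<Longrightarrow> blinfun_cscale c T \<in> carrier bounded_ops"
  by (simp add: mem_bounded_ops cscale_cscale mult.commute)

lemma norm_blinfun_cscale: "norm (blinfun_cscale c T) \<le> cmod c * norm T"
  by (rule norm_blinfun_bound)
     (simp_all add: norm_cscale mult.assoc mult_left_mono norm_blinfun)

lemma op_adjoint_plus:
  assumes "S \<in> carrier bounded_ops" "T \<in> carrier bounded_ops"
  shows "op_adjoint (S + T) = op_adjoint S + op_adjoint T"
  by (rule op_adjoint_unique)
     (simp add: blinfun.bilinear_simps cinner_add_left cinner_add_right cinner_op_adjoint assms)

lemma op_adjoint_cscale: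
  assumes "T \<in> carrier bounded_ops"
  shows "op_adjoint (blinfun_cscale c T) = blinfun_cscale (cnj c) (op_adjoint T)"
  by (rule op_adjoint_unique)
     (simp add: cinner_cscale_left cinner_cscale_right cinner_op_adjoint assms)

lemma op_adjoint_compose:
  assumes "S \<in> carrier bounded_ops" "T \<in> carrier bounded_ops"
  shows "op_adjoint (S o\<^sub>L T) = op_adjoint T o\<^sub>L op_adjoint S"
  by (rule op_adjoint_unique) (simp add: cinner_op_adjoint assms)

lemma op_adjoint_op_adjoint:
  assumes "T \<in> carrier bounded_ops"
  shows "op_adjoint (op_adjoint T) = T"
  by (rule op_adjoint_unique) (simp add: cinner_op_adjoint' assms)

section \<open>The weak operator topology\<close>

lemma topspace_wot [simp]: "topspace weak_operator_topology = carrier bounded_ops"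
  by (simp add: weak_operator_topology_def topspace_pullback_topology)

lemma continuous_map_wot_cinner:
  "continuous_map weak_operator_topology euclidean
     (\<lambda>T :: 'h::complex_hilbert_space \<Rightarrow>\<^sub>L 'h. cinner (T x) y)"
proof -
  have "continuous_map (product_topology (\<lambda>i. euclidean) UNIV) euclidean (\<lambda>f :: 'h \<times> 'h \<Rightarrow> complex. f (x, y))"
    by (rule continuous_map_product_projection) simp
  then have "continuous_map weak_operator_topology euclidean
      ((\<lambda>f. f (x, y)) \<circ> (\<lambda>T (x, y). cinner (blinfun_apply T x) y))"
    unfolding weak_operator_topology_def euclidean_product_topology by (rule continuous_map_pullback)
  then show ?thesis by (simp add: o_def)
qed

lemma continuous_map_into_wot:
  assumes "\<And>t. t \<in> topspace X \<Longrightarrow> g t \<in> carrier bounded_ops"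
    and "\<And>x y. continuous_map X euclidean (\<lambda>t. cinner (blinfun_apply (g t) x) y)"
  shows "continuous_map X weak_operator_topology g"
  unfolding weak_operator_topology_def
proof (rule continuous_map_pullback')
  show "topspace X \<subseteq> g -` carrier bounded_ops" using assms(1) by blast
  show "continuous_map X euclidean ((\<lambda>T (x, y). cinner (blinfun_apply T x) y) \<circ> g)"
    unfolding euclidean_product_topology[symmetric] continuous_map_componentwise_UNIV
    using assms(2) by (auto simp: o_def)
qed

text \<open>Serves to extend closure properties from the image of A to N in one variable at a time,
  which suffices where an operation is only separately continuous.\<close>

lemma wot_closure_image:
  assumes "\<And>T. T \<in> carrier bounded_ops \<Longrightarrow> g T \<in> carrier bounded_ops"
    and "\<And>x y. continuous_map weak_operator_topology euclidean (\<lambda>T. cinner (blinfun_apply (g T) x) y)"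
    and "\<And>T. T \<in> S \<Longrightarrow> g T \<in> weak_operator_topology closure_of R"
    and "T \<in> weak_operator_topology closure_of S"
  shows "g T \<in> weak_operator_topology closure_of R"
proof -
  have "continuous_map weak_operator_topology weak_operator_topology g"
    by (rule continuous_map_into_wot) (use assms in auto)
  then have "g ` (weak_operator_topology closure_of S) \<subseteq> weak_operator_topology closure_of (g ` S)"
    by (rule continuous_map_image_closure_subset)
  also have "\<dots> \<subseteq> weak_operator_topology closure_of R"
    using assms(3) by (intro closure_of_minimal) auto
  finally show ?thesis using assms(4) by blast
qed

lemma wot_closure_eqI:
  fixes f g :: "('h::complex_hilbert_space \<Rightarrow>\<^sub>L 'h) \<Rightarrow> complex"
  assumes "continuous_map weak_operator_topology euclidean f"
    and "continuous_map weak_operator_topology euclidean g"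
    and "\<And>T. T \<in> S \<Longrightarrow> f T = g T"
    and "T \<in> weak_operator_topology closure_of S"
  shows "f T = g T"
proof -
  have "closedin weak_operator_topology {T \<in> topspace weak_operator_topology. f T - g T \<in> {0}}"
    using assms(1,2) by (intro closedin_continuous_map_preimage[of _ euclidean] continuous_map_diff) auto
  moreover have "topspace weak_operator_topology \<inter> S \<subseteq> {T \<in> topspace weak_operator_topology. f T - g T \<in> {0}}"
    using assms(3) by auto
  ultimately have "weak_operator_topology closure_of S \<subseteq> {T \<in> topspace weak_operator_topology. f T - g T \<in> {0}}"
    by (metis closure_of_minimal closure_of_restrict)
  then show ?thesis using assms(4) by auto
qed

section \<open>The tracial GNS representation\<close>

locale tracial_gns =
  fixes \<tau> :: "'a::unital_cstar_algebra \<Rightarrow> complex"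
    and \<pi> :: "'a \<Rightarrow> ('h::complex_hilbert_space \<Rightarrow>\<^sub>L 'h)"
    and \<xi> :: 'h
  assumes tr: "tracial \<tau>"
    and gns: "gns_representation \<tau> \<pi> \<xi>"
begin

abbreviation N :: "('h \<Rightarrow>\<^sub>L 'h) set" where
  "N \<equiv> weak_operator_topology closure_of range \<pi>"

lemma pi_closed: "\<pi> a \<in> carrier bounded_ops"
  and pi_mult: "\<pi> (a * b) = \<pi> a o\<^sub>L \<pi> b"
  and pi_add: "\<pi> (a + b) = \<pi> a + \<pi> b"
  and pi_one: "\<pi> 1 = id_blinfun"
  and pi_cscale: "\<pi> (c *\<^sub>C a) = blinfun_cscale c (\<pi> a)"
  and pi_star: "\<pi> (star a) = op_adjoint (\<pi> a)"
  using gns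
  by (auto simp: gns_representation_def star_hom_def ring_hom_def cstar_alg_def bounded_ops_def)

lemma pi_zero: "\<pi> 0 = 0"
  using pi_add[of 0 0] by simp

lemma pi_diff: "\<pi> (a - b) = \<pi> a - \<pi> b"
  using pi_add[of "a - b" b] by (simp add: eq_diff_eq)

lemma pi_scaleR_apply: "\<pi> (r *\<^sub>R a) v = r *\<^sub>R \<pi> a v"
  by (simp add: scaleR_cscale pi_cscale)

lemma cinner_pi_star: "cinner (\<pi> (star a) u) v = cinner u (\<pi> a v)"
  by (simp add: pi_star cinner_op_adjoint'[OF pi_closed])

text \<open>If \<open>\<parallel>a\<parallel> \<le> 1/2\<close> then \<open>1 - a\<^sup>* a\<close> is the square of a selfadjoint element, which makes
  \<open>\<parallel>v\<parallel>\<^sup>2 - \<parallel>\<pi> a v\<parallel>\<^sup>2\<close> nonnegative.\<close>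

lemma norm_pi_apply_le: "norm (\<pi> a v) \<le> 2 * norm a * norm v"
proof -
  have half: "norm (\<pi> a v) \<le> norm v" if a: "norm a \<le> 1/2" for a
  proof -
    have "norm (star a * a) \<le> (1/2)\<^sup>2"
      using power_mono[OF a] by (simp add: cstar_identity)
    then have "norm (star a * a) \<le> 1/2" by (simp add: power2_eq_square)
    then obtain c where c: "star c = c" "1 - star a * a = c * c"
      using one_minus_is_square[of "star a * a"] by (auto simp: star_mult star_star)
    have "v = \<pi> (star a * a + c * c) v" by (simp add: pi_one flip: c(2))
    also have "\<dots> = \<pi> (star a) (\<pi> a v) + \<pi> (star c) (\<pi> c v)"
      by (simp add: pi_add pi_mult c blinfun.add_left)
    finally have "cinner v v = cinner (\<pi> a v) (\<pi> a v) + cinner (\<pi> c v) (\<pi> c v)"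
      using cinner_add_left[of "\<pi> (star a) (\<pi> a v)" "\<pi> (star c) (\<pi> c v)" v]
      by (simp only: cinner_pi_star)
    then have "(norm v)\<^sup>2 = (norm (\<pi> a v))\<^sup>2 + (norm (\<pi> c v))\<^sup>2"
      by (simp flip: cinner_self)
    then have "(norm (\<pi> a v))\<^sup>2 \<le> (norm v)\<^sup>2" by simp
    then show ?thesis by (simp add: power2_le_iff_abs_le)
  qed
  show ?thesis
  proof (cases "a = 0")
    case True then show ?thesis by (simp add: pi_zero)
  next
    case False
    \<comment> \<open>Scaling to norm 1/2, where the square root is available, is the origin of the
      factor 2; any fixed constant serves later.\<close>
    then have "norm (\<pi> a v) = 2 * norm a * norm (\<pi> ((1 / (2 * norm a)) *\<^sub>R a) v)"
      by (simp add: pi_scaleR_apply)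
    also have "\<dots> \<le> 2 * norm a * norm v"
      using False by (intro mult_left_mono half) auto
    finally show ?thesis .
  qed
qed

lemma norm_pi_le: "norm (\<pi> a) \<le> 2 * norm a"
  by (rule norm_blinfun_bound) (simp_all add: norm_pi_apply_le)

lemma N_subset: "T \<in> N \<Longrightarrow> T \<in> carrier bounded_ops"
  using closure_of_subset_topspace[of weak_operator_topology "range \<pi>"] by auto

lemma pi_in_N: "\<pi> a \<in> N"
  using closure_of_subset[of "range \<pi>" weak_operator_topology] pi_closed by auto

text \<open>Moving \<open>S\<close> across the inner product as its adjoint leaves a matrix
  coefficient of \<open>T\<close> alone.\<close>

lemma continuous_map_wot_cinner_right:
  assumes "S \<in> carrier bounded_ops"
  shows "continuous_map weak_operator_topology euclidean (\<lambda>T. cinner (S (blinfun_apply T x)) y)"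
  unfolding cinner_op_adjoint[OF assms] by (rule continuous_map_wot_cinner)

lemma N_compose:
  assumes S: "S \<in> N" and T: "T \<in> N"
  shows "S o\<^sub>L T \<in> N"
proof -
  \<comment> \<open>The left factor runs over N while the right one stays in the image of A;
    afterwards the right factor runs over N.\<close>
  have *: "R o\<^sub>L \<pi> a \<in> N" if R: "R \<in> N" for R a
    by (rule wot_closure_image[OF _ _ _ R])
       (auto simp: bounded_ops_compose pi_closed pi_in_N continuous_map_wot_cinner simp flip: pi_mult)
  show ?thesis
    by (rule wot_closure_image[OF _ _ _ T])
       (auto simp: bounded_ops_compose N_subset[OF S] continuous_map_wot_cinner_right * S)
qed

lemma N_plus:
  assumes S: "S \<in> N" and T: "T \<in> N"
  shows "S + T \<in> N"
proof -
  have cont: "continuous_map weak_operator_topology euclidean (\<lambda>T. cinner ((blinfun_apply (R + T)) x) y)"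
    for R :: "'h \<Rightarrow>\<^sub>L 'h" and x y
    by (simp add: blinfun.add_left cinner_add_left continuous_map_add continuous_map_wot_cinner)
  have *: "\<pi> a + R \<in> N" if R: "R \<in> N" for R a
    by (rule wot_closure_image[OF _ _ _ R])
       (auto simp: bounded_ops_plus pi_closed pi_in_N cont simp flip: pi_add)
  have "T + S \<in> N"
  proof (rule wot_closure_image[OF _ _ _ T])
    show "continuous_map weak_operator_topology euclidean (\<lambda>T. cinner (blinfun_apply (T + S) x) y)" for x y
      using cont[of S] by (simp only: add.commute)
  qed (use * S in \<open>auto simp: bounded_ops_plus N_subset[OF S]\<close>)
  then show ?thesis by (simp add: add.commute)
qed

lemma N_cscale:
  assumes T: "T \<in> N"
  shows "blinfun_cscale c T \<in> N"
proof (rule wot_closure_image[OF _ _ _ T])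
  have eq: "cinner (blinfun_cscale c T x) y = cinner (T x) (cnj c *\<^sub>C y)" for T x y
    by (simp add: cinner_cscale_left cinner_cscale_right)
  show "continuous_map weak_operator_topology euclidean (\<lambda>T. cinner (blinfun_cscale c T x) y)" for x y
    unfolding eq by (rule continuous_map_wot_cinner)
qed (auto simp: bounded_ops_cscale pi_in_N simp flip: pi_cscale)

lemma N_adjoint:
  assumes T: "T \<in> N"
  shows "op_adjoint T \<in> N"
proof (rule wot_closure_image[OF _ _ _ T])
  show "continuous_map weak_operator_topology euclidean (\<lambda>T. cinner (op_adjoint T x) y)" for x y :: 'h
  proof (rule continuous_map_eq)
    have "continuous_map weak_operator_topology euclidean (cnj \<circ> (\<lambda>T :: 'h \<Rightarrow>\<^sub>L 'h. cinner (T y) x))"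
      by (intro continuous_map_compose[of _ euclidean] continuous_map_wot_cinner)
         (auto intro: continuous_intros)
    then show "continuous_map weak_operator_topology euclidean (\<lambda>T :: 'h \<Rightarrow>\<^sub>L 'h. cnj (cinner (T y) x))"
      by (simp add: o_def)
    show "cnj (cinner (T y) x) = cinner (op_adjoint T x) y"
      if "T \<in> topspace weak_operator_topology" for T
      using that by (simp add: cinner_op_adjoint flip: cinner_commute)
  qed
qed (auto simp: op_adjoint_closed pi_in_N simp flip: pi_star)

lemma blinfun_cscale_of_real: "blinfun_cscale (complex_of_real r) T = r *\<^sub>R T"
  by (rule blinfun_eqI) (simp add: cscale_of_real blinfun.scaleR_left)

lemma N_scaleR: "T \<in> N \<Longrightarrow> r *\<^sub>R T \<in> N"
  using N_cscale[of T "complex_of_real r"] by (simp add: blinfun_cscale_of_real)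

lemma N_uminus: "T \<in> N \<Longrightarrow> - T \<in> N"
  using N_scaleR[of T "-1"] by simp

lemma N_diff: "S \<in> N \<Longrightarrow> T \<in> N \<Longrightarrow> S - T \<in> N"
  using N_plus[of S "- T"] N_uminus[of T] by simp

section \<open>The trace on N and two-sided bounds for the 2-norm\<close>

lemma N_trace:
  assumes S: "S \<in> N" and T: "T \<in> N"
  shows "cinner (S (T \<xi>)) \<xi> = cinner (T (S \<xi>)) \<xi>"
proof -
  \<comment> \<open>On the image of A the identity is traciality of \<tau>; as for products, it is
    extended to N in one variable at a time.\<close>
  have *: "cinner (R (\<pi> a \<xi>)) \<xi> = cinner (\<pi> a (R \<xi>)) \<xi>" if R: "R \<in> N" for R a
  proof (rule wot_closure_eqI[OF _ _ _ R])
    fix T assume "T \<in> range \<pi>"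
    then obtain b where b: "T = \<pi> b" by blast
    have "\<tau> (b * a) = \<tau> (a * b)" using tr by (simp add: tracial_def)
    then show "cinner (T (\<pi> a \<xi>)) \<xi> = cinner (\<pi> a (T \<xi>)) \<xi>"
      using gns by (simp add: gns_representation_def b pi_mult)
  qed (intro continuous_map_wot_cinner continuous_map_wot_cinner_right pi_closed)+
  show ?thesis
  proof (rule wot_closure_eqI[OF _ _ _ T])
    fix T assume "T \<in> range \<pi>"
    then show "cinner (S (T \<xi>)) \<xi> = cinner (T (S \<xi>)) \<xi>" using *[OF S] by auto
  qed (intro continuous_map_wot_cinner continuous_map_wot_cinner_right N_subset S)+
qed

text \<open>The trace identity applied to \<open>T\<close> and its adjoint. All later consequences
  of traciality rest on this equality.\<close>

lemma norm_adjoint_xi: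
  assumes T: "T \<in> N"
  shows "norm (op_adjoint T \<xi>) = norm (T \<xi>)"
proof -
  have "cinner (op_adjoint T \<xi>) (op_adjoint T \<xi>) = cinner (T \<xi>) (T \<xi>)"
    using N_trace[OF T N_adjoint[OF T]]
    by (simp add: cinner_op_adjoint'[OF N_subset[OF T]] cinner_op_adjoint[OF N_subset[OF T]])
  then have "(norm (op_adjoint T \<xi>))\<^sup>2 = (norm (T \<xi>))\<^sup>2" by (simp flip: cinner_self)
  then show ?thesis by simp
qed

text \<open>Passing to adjoints turns right multiplication by \<open>T\<close> into left
  multiplication by its adjoint, where the operator norm bound applies.\<close>

lemma norm_compose_xi_le:
  assumes S: "S \<in> N" and T: "T \<in> N"
  shows "norm (S (T \<xi>)) \<le> norm T * norm (S \<xi>)"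
proof -
  have "norm (S (T \<xi>)) = norm (op_adjoint (S o\<^sub>L T) \<xi>)"
    by (simp add: norm_adjoint_xi N_compose S T)
  also have "\<dots> = norm (op_adjoint T (op_adjoint S \<xi>))"
    by (simp add: op_adjoint_compose N_subset S T)
  also have "\<dots> \<le> norm T * norm (op_adjoint S \<xi>)"
    by (rule norm_op_adjoint_apply[OF N_subset[OF T]])
  finally show ?thesis by (simp add: norm_adjoint_xi S)
qed

section \<open>Density of A in N for the 2-norm, with norm bounds\<close>

lemma pi_xi_dense: "0 < e \<Longrightarrow> \<exists>a. norm (\<pi> a \<xi> - v) < e"
proof -
  assume "0 < e"
  \<comment> \<open>Cyclicity makes the orbit of \<xi> dense in the whole space, so it approximates
    \<open>T \<xi>\<close> for any \<open>T\<close> in N, though without control on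
    \<open>norm a\<close>.\<close>
  have "v \<in> closure (range (\<lambda>a. \<pi> a \<xi>))" using gns by (simp add: gns_representation_def)
  then show ?thesis using \<open>0 < e\<close> by (auto simp: closure_approachable dist_norm)
qed

text \<open>The selfadjoint part of an approximant works: \<open>star a\<close> is as close as
  \<open>a\<close>, because \<open>\<pi> a - T\<close> and its adjoint have the same 2-norm.\<close>

lemma pi_xi_dense_selfadjoint:
  assumes T: "T \<in> N" "op_adjoint T = T" and e: "0 < e"
  shows "\<exists>a. star a = a \<and> norm (\<pi> a \<xi> - T \<xi>) < e"
proof -
  obtain a where a: "norm (\<pi> a \<xi> - T \<xi>) < e" using pi_xi_dense[OF e] by blast
  define b where "b = (1/2) *\<^sub>R (a + star a)"
  have "op_adjoint (\<pi> a - T) = \<pi> (star a) - T"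
    using op_adjoint_plus[of "\<pi> a - T" T] N_subset[OF N_diff[OF pi_in_N T(1)]] N_subset[OF T(1)] T(2)
    by (simp add: pi_star)
  then have a': "norm (\<pi> (star a) \<xi> - T \<xi>) < e"
    using norm_adjoint_xi[OF N_diff[OF pi_in_N T(1)], of a] a by (simp add: blinfun.diff_left)
  have "\<pi> b \<xi> - T \<xi> = (1/2) *\<^sub>R ((\<pi> a \<xi> - T \<xi>) + (\<pi> (star a) \<xi> - T \<xi>))"
    by (simp add: b_def pi_scaleR_apply pi_add blinfun.add_left algebra_simps flip: scaleR_2)
  also have "norm \<dots> < e"
    using norm_triangle_ineq[of "\<pi> a \<xi> - T \<xi>" "\<pi> (star a) \<xi> - T \<xi>"] a a' by simp
  finally have "norm (\<pi> b \<xi> - T \<xi>) < e" .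
  moreover have "star b = b" by (simp add: b_def star_scaleR star_add star_star add.commute)
  ultimately show ?thesis by blast
qed

text \<open>A selfadjoint \<open>x\<close> with \<open>\<parallel>x\<parallel> \<le> 1/4\<close> has the form \<open>y (1 + y\<^sup>2)\<^sup>-\<^sup>1\<close>, up to an error \<open>e\<close>:
  iterate \<open>y \<mapsto> x + y\<^sup>2 x\<close>.\<close>

lemma approximate_resolvent_preimage:
  assumes x: "x \<in> N" "op_adjoint x = x" "norm x \<le> 1/4"
  shows "\<exists>y\<in>N. op_adjoint y = y \<and> y o\<^sub>L x = x o\<^sub>L y \<and> norm y \<le> 1/2 \<and>
    norm (y - (x + (y o\<^sub>L y o\<^sub>L x))) \<le> (1/4) ^ n"
proof (induction n)
  case 0
  show ?case
  proof (rule bexI[of _ 0], intro conjI)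
    show "op_adjoint 0 = (0 :: 'h \<Rightarrow>\<^sub>L 'h)"
      by (rule op_adjoint_unique) (simp add: cinner_eq_inner)
    show "0 \<in> N" using pi_in_N[of 0] by (simp add: pi_zero)
  qed (use x in auto)
next
  case (Suc n)
  then obtain y where y: "y \<in> N" "op_adjoint y = y" "y o\<^sub>L x = x o\<^sub>L y" "norm y \<le> 1/2"
    and err: "norm (y - (x + (y o\<^sub>L y o\<^sub>L x))) \<le> (1/4) ^ n" by blast
  have yx: "y (x v) = x (y v)" for v using arg_cong[OF y(3), of "\<lambda>T. T v"] by simp
  define z where "z = x + (y o\<^sub>L y o\<^sub>L x)"
  show ?case
  proof (rule bexI[of _ z], intro conjI)
    show "z \<in> N" unfolding z_def by (intro N_plus N_compose x y)
    have "op_adjoint z = x + (x o\<^sub>L (y o\<^sub>L y))"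
      \<comment> \<open>Taking adjoints reverses the product; it is again \<open>y y x\<close>
        because \<open>y\<close> commutes with \<open>x\<close>. This is why commutation is carried
        through the induction.\<close>
      unfolding z_def using N_subset[OF x(1)] N_subset[OF y(1)]
      by (simp add: op_adjoint_plus op_adjoint_compose bounded_ops_compose x(2) y(2))
    also have "\<dots> = z" unfolding z_def by (rule blinfun_eqI) (simp add: blinfun.add_left yx)
    finally show "op_adjoint z = z" .
    show "z o\<^sub>L x = x o\<^sub>L z"
      by (rule blinfun_eqI) (simp add: z_def blinfun.bilinear_simps yx)
    have "norm (y o\<^sub>L y o\<^sub>L x) \<le> norm y * norm y * norm x"
      by (meson mult_right_mono norm_blinfun_compose norm_ge_zero order_trans)
    also have "\<dots> \<le> (1/2) * (1/2) * (1/4)" using x y by (intro mult_mono) auto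
    finally show nz: "norm z \<le> 1/2"
      using norm_triangle_ineq[of x "y o\<^sub>L y o\<^sub>L x"] x by (simp add: z_def)
    \<comment> \<open>Here \<open>y - z\<close> is the old error, and y^2 - z^2 = y (y - z) + (y -
      z) z. The bounds 1/2, 1/2 on \<open>y\<close>, \<open>z\<close> and 1/4 on \<open>x\<close>
      give the factor 1/4.\<close>
    have "z - (x + (z o\<^sub>L z o\<^sub>L x)) = ((y o\<^sub>L (y - z)) + ((y - z) o\<^sub>L z)) o\<^sub>L x"
      by (rule blinfun_eqI) (simp add: z_def blinfun.bilinear_simps)
    also have "norm \<dots> \<le> norm ((y o\<^sub>L (y - z)) + ((y - z) o\<^sub>L z)) * norm x"
      by (rule norm_blinfun_compose)
    also have "\<dots> \<le> (norm y * norm (y - z) + norm (y - z) * norm z) * norm x"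
      by (intro mult_right_mono norm_triangle_le add_mono norm_blinfun_compose) auto
    also have "\<dots> \<le> ((1/2) * (1/4) ^ n + (1/4) ^ n * (1/2)) * (1/4)"
      using x y nz err by (intro mult_mono add_mono) (auto simp: z_def)
    finally show "norm (z - (x + (z o\<^sub>L z o\<^sub>L x))) \<le> (1/4) ^ Suc n" by simp
  qed
qed

text \<open>The approximant \<open>a\<close> of \<open>y\<close> has no norm bound, so the error is
  arranged to contain it only inside the contractions \<open>q\<close> and \<open>q * a\<close> and
  in the small \<open>w\<close>. Factors \<open>x\<close> and \<open>y x\<close> to the right of
  \<open>w\<close> are harmless by the 2-norm bound for right multiplication.\<close>

lemma kaplansky_selfadjoint:
  assumes x: "x \<in> N" "op_adjoint x = x" "norm x \<le> 1/4" and e: "0 < e"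
  shows "\<exists>a. norm a \<le> 1 \<and> norm (\<pi> a \<xi> - x \<xi>) < e"
proof -
  \<comment> \<open>The error will be at most \<open>6 * d + 2 * (d * norm \<xi>)\<close>; taking 8
    where 3 would balance leaves room for a strict inequality.\<close>
  define d where "d = e / (2 * (8 + norm \<xi>))"
  have d: "0 < d" using e by (simp add: d_def add_pos_nonneg)
  obtain n where n: "(1/4 :: real) ^ n < d" using real_arch_pow_inv[OF d, of "1/4"] by auto
  obtain y where y: "y \<in> N" "op_adjoint y = y" "y o\<^sub>L x = x o\<^sub>L y" "norm y \<le> 1/2"
    and err: "norm (y - (x + (y o\<^sub>L y o\<^sub>L x))) \<le> (1/4) ^ n"
    using approximate_resolvent_preimage[OF x, of n] by blast
  have yx: "y (x v) = x (y v)" for v using arg_cong[OF y(3), of "\<lambda>T. T v"] by simp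
  define r where "r = y - (x + (y o\<^sub>L y o\<^sub>L x))"
  obtain a where a: "star a = a" "norm (\<pi> a \<xi> - y \<xi>) < d"
    using pi_xi_dense_selfadjoint[OF y(1,2) d] by blast
  obtain q where q: "q * (1 + a * a) = 1" "norm q \<le> 1" "norm (q * a) \<le> 1"
    using one_plus_square_invertible[OF a(1)] by blast
  define w where "w = y - \<pi> a"
  have w: "w \<in> N" unfolding w_def by (intro N_diff y pi_in_N)
  have wd: "norm (w \<xi>) \<le> d" using a(2) by (simp add: w_def blinfun.diff_left norm_minus_commute)
  have "x \<xi> - \<pi> (q * a) \<xi> = \<pi> (q * (1 + a * a)) (x \<xi>) - \<pi> (q * a) \<xi>"
    by (simp add: q(1) pi_one)
  also have "\<dots> = \<pi> q (x \<xi> + \<pi> a (\<pi> a (x \<xi>)) - \<pi> a \<xi>)"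
    by (simp add: pi_mult pi_add pi_one blinfun.bilinear_simps)
  \<comment> \<open>Insert x = y - y^2 x - r, and split the difference of the squares of
    \<open>y\<close> and \<open>\<pi> a\<close> as \<open>\<pi> a\<close> w + w y.\<close>
  also have "x \<xi> + \<pi> a (\<pi> a (x \<xi>)) - \<pi> a \<xi> = w \<xi> - \<pi> a (w (x \<xi>)) - w (y (x \<xi>)) - r \<xi>"
    by (simp add: w_def r_def blinfun.bilinear_simps algebra_simps)
  also have "\<pi> q \<dots> = \<pi> q (w \<xi>) - \<pi> (q * a) (w (x \<xi>)) - \<pi> q (w (y (x \<xi>))) - \<pi> q (r \<xi>)"
    by (simp add: pi_mult blinfun.bilinear_simps)
  also have "norm \<dots> \<le> 2 * d + 2 * d + 2 * d + 2 * (d * norm \<xi>)"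
  proof (intro norm_triangle_le_diff add_mono)
    have le2: "norm (\<pi> b v) \<le> 2 * c" if "norm b \<le> 1" "norm v \<le> c" for b v c
    proof -
      have "norm b * norm v \<le> 1 * c" using that by (intro mult_mono) auto
      then show ?thesis using norm_pi_apply_le[of b v] by simp
    qed
    show "norm (\<pi> q (w \<xi>)) \<le> 2 * d" by (rule le2[OF q(2) wd])
    have "norm (w (x \<xi>)) \<le> 1 * d"
      using norm_compose_xi_le[OF w x(1)] x(3) wd mult_mono[of "norm x" 1 "norm (w \<xi>)" d] by simp
    then show "norm (\<pi> (q * a) (w (x \<xi>))) \<le> 2 * d" by (intro le2 q(3)) simp
    have "norm (y o\<^sub>L x) \<le> 1 * 1"
      using x(3) y(4) by (intro order_trans[OF norm_blinfun_compose] mult_mono) auto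
    then have "norm (w (y (x \<xi>))) \<le> 1 * d"
      using norm_compose_xi_le[OF w N_compose[OF y(1) x(1)]] wd
        mult_mono[of "norm (y o\<^sub>L x)" 1 "norm (w \<xi>)" d] by simp
    then show "norm (\<pi> q (w (y (x \<xi>)))) \<le> 2 * d" by (intro le2 q(2)) simp
    have "norm (r \<xi>) \<le> d * norm \<xi>"
      using norm_blinfun[of r \<xi>] err n mult_right_mono[of "norm r" d "norm \<xi>"] by (simp add: r_def)
    then show "norm (\<pi> q (r \<xi>)) \<le> 2 * (d * norm \<xi>)" by (rule le2[OF q(2)])
  qed
  also have "\<dots> < 2 * (8 + norm \<xi>) * d" using d by (simp add: algebra_simps)
  also have "\<dots> = e"
  proof -
    have "0 < 2 * (8 + norm \<xi>)" by (simp add: add_pos_nonneg)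
    then have "2 * (8 + norm \<xi>) \<noteq> 0" by (metis less_irrefl)
    then show ?thesis unfolding d_def times_divide_eq_right by (rule nonzero_mult_div_cancel_left)
  qed
  finally show ?thesis using q(3) by (intro exI[of _ "q * a"]) (simp add: norm_minus_commute)
qed

text \<open>Real and imaginary parts of \<open>s *\<^sub>R x\<close> have norm at most 1/4 and are
  approximated by contractions; undoing the scale \<open>s = 1 / (4 * R)\<close> gives 2 / s = 8 R.
  The point is that this bound does not depend on \<open>e\<close>.\<close>

lemma kaplansky_density:
  assumes x: "x \<in> N" "norm x \<le> R" and e: "0 < e"
  shows "\<exists>a. norm a \<le> 8 * R \<and> norm (\<pi> a \<xi> - x \<xi>) < e"
proof (cases "R = 0")
  case True
  then have "x = 0" using x by simp
  then show ?thesis using True e by (intro exI[of _ 0]) (simp add: pi_zero)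
next
  case False
  then have R: "0 < R" using x(2) norm_ge_zero[of x] by linarith
  define s where "s = 1 / (4 * R)"
  have s: "0 < s" using R by (simp add: s_def)
  define xs where "xs = op_adjoint x"
  have xs: "xs \<in> N" "norm xs \<le> R" "op_adjoint xs = x"
    using x N_adjoint[OF x(1)] norm_op_adjoint_le[OF N_subset[OF x(1)]] op_adjoint_op_adjoint[OF N_subset[OF x(1)]]
    by (auto simp: xs_def)
  define h where "h = (s / 2) *\<^sub>R (x + xs)"
  define k where "k = blinfun_cscale (- \<i> * complex_of_real (s / 2)) (x - xs)"
  have h: "h \<in> N" unfolding h_def by (intro N_scaleR N_plus x xs)
  have k: "k \<in> N" unfolding k_def by (intro N_cscale N_diff x xs)
  have adj: "op_adjoint (x + xs) = x + xs" "op_adjoint (x - xs) = - (x - xs)"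
  proof -
    show "op_adjoint (x + xs) = x + xs"
      by (simp add: op_adjoint_plus N_subset x xs add.commute) (simp add: xs_def)
    have "op_adjoint (x - xs + xs) = op_adjoint (x - xs) + op_adjoint xs"
      by (intro op_adjoint_plus N_subset N_diff x xs)
    then show "op_adjoint (x - xs) = - (x - xs)" by (simp add: xs(3)) (simp add: xs_def algebra_simps)
  qed
  have "op_adjoint h = h"
    unfolding h_def blinfun_cscale_of_real[symmetric]
    by (subst op_adjoint_cscale) (simp_all add: adj N_subset N_plus x xs)
  moreover have "norm h \<le> 1/4"
  proof -
    have "norm h = s / 2 * norm (x + xs)" using s by (simp add: h_def)
    also have "\<dots> \<le> s / 2 * (R + R)"
      using s x xs by (intro mult_left_mono norm_triangle_le add_mono) auto
    finally show ?thesis using R by (simp add: s_def)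
  qed
  ultimately obtain a where a: "norm a \<le> 1" "norm (\<pi> a \<xi> - h \<xi>) < s * e / 2"
    using kaplansky_selfadjoint[OF h, of "s * e / 2"] s e by auto
  have "op_adjoint k = k"
  proof -
    have "op_adjoint k = blinfun_cscale (cnj (- \<i> * complex_of_real (s / 2))) (- (x - xs))"
      unfolding k_def by (subst op_adjoint_cscale) (simp_all add: adj N_subset N_diff x xs)
    also have "\<dots> = k"
      unfolding k_def
      by (rule blinfun_eqI) (simp add: blinfun.bilinear_simps cscale_diff_right cscale_minus_left)
    finally show ?thesis .
  qed
  moreover have "norm k \<le> 1/4"
  proof -
    have "norm k \<le> s / 2 * norm (x - xs)"
      using norm_blinfun_cscale[of "- \<i> * complex_of_real (s / 2)" "x - xs"] s
      by (simp add: k_def norm_mult)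
    also have "\<dots> \<le> s / 2 * (R + R)"
      using s x xs by (intro mult_left_mono norm_triangle_le_diff add_mono) auto
    finally show ?thesis using R by (simp add: s_def)
  qed
  ultimately obtain b where b: "norm b \<le> 1" "norm (\<pi> b \<xi> - k \<xi>) < s * e / 2"
    using kaplansky_selfadjoint[OF k, of "s * e / 2"] s e by auto
  define c where "c = (1 / s) *\<^sub>R (a + \<i> *\<^sub>C b)"
  have ik: "\<i> *\<^sub>C (- \<i> * complex_of_real (s / 2)) *\<^sub>C u = (s / 2) *\<^sub>R u" for u :: 'h
    unfolding cscale_cscale scaleR_cscale by simp
  have half: "(s / 2) *\<^sub>R (u + v) + (s / 2) *\<^sub>R (u - v) = s *\<^sub>R u" for u v :: 'h
    by (simp flip: scaleR_add_right scaleR_2)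
  have "h + blinfun_cscale \<i> k = s *\<^sub>R x"
    unfolding h_def k_def
    by (rule blinfun_eqI)
       (simp only: blinfun.add_left blinfun.scaleR_left blinfun.diff_left blinfun_cscale_apply ik half)
  then have "s *\<^sub>R x \<xi> = h \<xi> + \<i> *\<^sub>C k \<xi>"
    by (metis blinfun.add_left blinfun.scaleR_left blinfun_cscale_apply)
  then have "s *\<^sub>R (\<pi> c \<xi> - x \<xi>) = (\<pi> a \<xi> - h \<xi>) + \<i> *\<^sub>C (\<pi> b \<xi> - k \<xi>)"
    using s by (simp add: c_def pi_scaleR_apply pi_add pi_cscale blinfun.add_left scaleR_diff_right cscale_diff_right)
  then have "s * norm (\<pi> c \<xi> - x \<xi>) = norm ((\<pi> a \<xi> - h \<xi>) + \<i> *\<^sub>C (\<pi> b \<xi> - k \<xi>))"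
    using s by (metis abs_of_pos norm_scaleR)
  also have "\<dots> \<le> norm (\<pi> a \<xi> - h \<xi>) + norm (\<pi> b \<xi> - k \<xi>)"
    using norm_triangle_ineq[of "\<pi> a \<xi> - h \<xi>" "\<i> *\<^sub>C (\<pi> b \<xi> - k \<xi>)"] by (simp add: norm_cscale)
  also have "\<dots> < s * e" using a b by simp
  finally have "norm (\<pi> c \<xi> - x \<xi>) < e" using s by simp
  moreover have "norm c \<le> 8 * R"
  proof -
    have "norm (a + \<i> *\<^sub>C b) \<le> 2"
      using norm_triangle_ineq[of a "\<i> *\<^sub>C b"] a b by (simp add: norm_cscale)
    then have "norm c \<le> 1 / s * 2"
      unfolding c_def norm_scaleR using s by (intro mult_mono) auto
    then show ?thesis by (simp add: s_def)
  qed
  ultimately show ?thesis by blast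
qed

end

section \<open>Calculus in ultrapowers\<close>

text \<open>The structures to which the ultrapower construction is applied; \<open>\<nu>\<close> is the operator norm
  or the 2-norm.\<close>

locale ultrapower_base =
  fixes M :: "('b::real_normed_vector) star_algebra" and \<nu> :: "'b \<Rightarrow> real" and \<omega> :: "nat filter"
  assumes zero_M: "\<zero>\<^bsub>M\<^esub> = 0" and add_M: "add M = (+)"
    and zero_closed: "0 \<in> carrier M" and one_closed: "\<one>\<^bsub>M\<^esub> \<in> carrier M"
    and plus_closed: "\<And>x y. x \<in> carrier M \<Longrightarrow> y \<in> carrier M \<Longrightarrow> x + y \<in> carrier M"
    and uminus_closed: "\<And>x. x \<in> carrier M \<Longrightarrow> - x \<in> carrier M"
    and mult_closed: "\<And>x y. x \<in> carrier M \<Longrightarrow> y \<in> carrier M \<Longrightarrow> x \<otimes>\<^bsub>M\<^esub> y \<in> carrier M"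
    and smult_closed: "\<And>x c. x \<in> carrier M \<Longrightarrow> c \<odot>\<^bsub>M\<^esub> x \<in> carrier M"
    and involution_closed: "\<And>x. x \<in> carrier M \<Longrightarrow> involution M x \<in> carrier M"
    and m_assoc: "\<And>x y z. x \<in> carrier M \<Longrightarrow> y \<in> carrier M \<Longrightarrow> z \<in> carrier M \<Longrightarrow>
      x \<otimes>\<^bsub>M\<^esub> y \<otimes>\<^bsub>M\<^esub> z = x \<otimes>\<^bsub>M\<^esub> (y \<otimes>\<^bsub>M\<^esub> z)"
    and l_one: "\<And>x. x \<in> carrier M \<Longrightarrow> \<one>\<^bsub>M\<^esub> \<otimes>\<^bsub>M\<^esub> x = x"
    and r_one: "\<And>x. x \<in> carrier M \<Longrightarrow> x \<otimes>\<^bsub>M\<^esub> \<one>\<^bsub>M\<^esub> = x"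
    and l_distr: "\<And>x y z. x \<in> carrier M \<Longrightarrow> y \<in> carrier M \<Longrightarrow> z \<in> carrier M \<Longrightarrow>
      (x + y) \<otimes>\<^bsub>M\<^esub> z = x \<otimes>\<^bsub>M\<^esub> z + y \<otimes>\<^bsub>M\<^esub> z"
    and r_distr: "\<And>x y z. x \<in> carrier M \<Longrightarrow> y \<in> carrier M \<Longrightarrow> z \<in> carrier M \<Longrightarrow>
      z \<otimes>\<^bsub>M\<^esub> (x + y) = z \<otimes>\<^bsub>M\<^esub> x + z \<otimes>\<^bsub>M\<^esub> y"
    and smult_plus: "\<And>c x y. x \<in> carrier M \<Longrightarrow> y \<in> carrier M \<Longrightarrow> c \<odot>\<^bsub>M\<^esub> (x + y) = c \<odot>\<^bsub>M\<^esub> x + c \<odot>\<^bsub>M\<^esub> y"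
    and involution_plus: "\<And>x y. x \<in> carrier M \<Longrightarrow> y \<in> carrier M \<Longrightarrow>
      involution M (x + y) = involution M x + involution M y"
    and norm_mult_le: "\<And>x y. x \<in> carrier M \<Longrightarrow> y \<in> carrier M \<Longrightarrow> norm (x \<otimes>\<^bsub>M\<^esub> y) \<le> norm x * norm y"
    and norm_smult_le: "\<And>c x. x \<in> carrier M \<Longrightarrow> norm (c \<odot>\<^bsub>M\<^esub> x) \<le> cmod c * norm x"
    and norm_involution_le: "\<And>x. x \<in> carrier M \<Longrightarrow> norm (involution M x) \<le> norm x"
    and nu_zero: "\<nu> 0 = 0"
    and nu_nonneg: "\<And>x. x \<in> carrier M \<Longrightarrow> 0 \<le> \<nu> x"
    and nu_minus: "\<And>x. x \<in> carrier M \<Longrightarrow> \<nu> (- x) = \<nu> x"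
    and nu_plus: "\<And>x y. x \<in> carrier M \<Longrightarrow> y \<in> carrier M \<Longrightarrow> \<nu> (x + y) \<le> \<nu> x + \<nu> y"
    and nu_mult_left: "\<And>x y. x \<in> carrier M \<Longrightarrow> y \<in> carrier M \<Longrightarrow> \<nu> (x \<otimes>\<^bsub>M\<^esub> y) \<le> norm x * \<nu> y"
    and nu_mult_right: "\<And>x y. x \<in> carrier M \<Longrightarrow> y \<in> carrier M \<Longrightarrow> \<nu> (x \<otimes>\<^bsub>M\<^esub> y) \<le> norm y * \<nu> x"
    and nu_smult: "\<And>c x. x \<in> carrier M \<Longrightarrow> \<nu> (c \<odot>\<^bsub>M\<^esub> x) \<le> cmod c * \<nu> x"
    and nu_involution: "\<And>x. x \<in> carrier M \<Longrightarrow> \<nu> (involution M x) \<le> \<nu> x"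
begin

lemma mem_linf:
  "X \<in> carrier (linf M) \<longleftrightarrow> (\<forall>n. X n \<in> carrier M) \<and> (\<exists>R\<ge>0. \<forall>n. norm (X n) \<le> R)"
  by (auto simp: linf_def bounded_range_iff)

lemma mem_null_seqs:
  "X \<in> null_seqs \<omega> \<nu> M \<longleftrightarrow> X \<in> carrier (linf M) \<and> ((\<lambda>n. \<nu> (X n)) \<longlongrightarrow> 0) \<omega>"
  by (simp add: null_seqs_def)

lemma linf_simps:
  "X \<otimes>\<^bsub>linf M\<^esub> Y = (\<lambda>n. X n \<otimes>\<^bsub>M\<^esub> Y n)" "X \<oplus>\<^bsub>linf M\<^esub> Y = (\<lambda>n. X n + Y n)"
  "\<one>\<^bsub>linf M\<^esub> = (\<lambda>n. \<one>\<^bsub>M\<^esub>)" "\<zero>\<^bsub>linf M\<^esub> = (\<lambda>n. 0)" "c \<odot>\<^bsub>linf M\<^esub> X = (\<lambda>n. c \<odot>\<^bsub>M\<^esub> X n)"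
  "involution (linf M) X = (\<lambda>n. involution M (X n))"
  by (simp_all add: linf_def zero_M add_M)

lemma linf_plus:
  assumes "X \<in> carrier (linf M)" "Y \<in> carrier (linf M)"
  shows "(\<lambda>n. X n + Y n) \<in> carrier (linf M)"
proof -
  obtain R S where "R \<ge> 0" "S \<ge> 0" "\<And>n. norm (X n) \<le> R" "\<And>n. norm (Y n) \<le> S"
    using assms by (auto simp: mem_linf)
  then have "\<forall>n. norm (X n + Y n) \<le> R + S" "R + S \<ge> 0" by (auto intro: norm_triangle_le add_mono)
  then show ?thesis using assms unfolding mem_linf by (blast intro: plus_closed)
qed

lemma linf_uminus: "X \<in> carrier (linf M) \<Longrightarrow> (\<lambda>n. - X n) \<in> carrier (linf M)"
  by (auto simp: mem_linf uminus_closed)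

lemma linf_diff:
  assumes "X \<in> carrier (linf M)" "Y \<in> carrier (linf M)"
  shows "(\<lambda>n. X n - Y n) \<in> carrier (linf M)"
  using linf_plus[OF assms(1) linf_uminus[OF assms(2)]] by simp

lemma linf_mult:
  assumes "X \<in> carrier (linf M)" "Y \<in> carrier (linf M)"
  shows "(\<lambda>n. X n \<otimes>\<^bsub>M\<^esub> Y n) \<in> carrier (linf M)"
proof -
  obtain R S where RS: "R \<ge> 0" "S \<ge> 0" "\<And>n. norm (X n) \<le> R" "\<And>n. norm (Y n) \<le> S"
    and c: "\<And>n. X n \<in> carrier M" "\<And>n. Y n \<in> carrier M"
    using assms by (auto simp: mem_linf)
  have "norm (X n \<otimes>\<^bsub>M\<^esub> Y n) \<le> R * S" for n
    using norm_mult_le[OF c] RS by (meson mult_mono norm_ge_zero order_trans)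
  then have "\<forall>n. norm (X n \<otimes>\<^bsub>M\<^esub> Y n) \<le> R * S" "R * S \<ge> 0" using RS by auto
  then show ?thesis using c unfolding mem_linf by (blast intro: mult_closed)
qed

lemma linf_smult:
  assumes "X \<in> carrier (linf M)"
  shows "(\<lambda>n. c \<odot>\<^bsub>M\<^esub> X n) \<in> carrier (linf M)"
proof -
  obtain R where R: "R \<ge> 0" "\<And>n. norm (X n) \<le> R" and c: "\<And>n. X n \<in> carrier M"
    using assms by (auto simp: mem_linf)
  have "norm (c \<odot>\<^bsub>M\<^esub> X n) \<le> cmod c * R" for n
    using norm_smult_le[OF c] R by (meson mult_left_mono norm_ge_zero order_trans)
  then have "\<forall>n. norm (c \<odot>\<^bsub>M\<^esub> X n) \<le> cmod c * R" "cmod c * R \<ge> 0" using R by auto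
  then show ?thesis using c unfolding mem_linf by (blast intro: smult_closed)
qed

lemma linf_involution: "X \<in> carrier (linf M) \<Longrightarrow> (\<lambda>n. involution M (X n)) \<in> carrier (linf M)"
  unfolding mem_linf by (meson involution_closed norm_involution_le order_trans)

lemma linf_const: "b \<in> carrier M \<Longrightarrow> (\<lambda>n. b) \<in> carrier (linf M)"
  by (auto simp: mem_linf intro!: exI[of _ "norm b"])

lemma linf_apply: "X \<in> carrier (linf M) \<Longrightarrow> X n \<in> carrier M"
  by (simp add: mem_linf)

lemma ring_linf: "ring (linf M)"
proof (intro ringI abelian_groupI monoidI)
  fix X assume X: "X \<in> carrier (linf M)"
  then show "\<exists>Y\<in>carrier (linf M). Y \<oplus>\<^bsub>linf M\<^esub> X = \<zero>\<^bsub>linf M\<^esub>"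
    by (intro bexI[of _ "\<lambda>n. - X n"]) (auto simp: linf_simps linf_uminus)
qed (auto simp: linf_simps linf_plus linf_mult linf_const zero_closed one_closed add_ac
      linf_apply m_assoc l_one r_one l_distr r_distr)

lemma tendsto_nu_zeroI:
  assumes "\<And>n. Y n \<in> carrier M" "\<And>n. \<nu> (Y n) \<le> g n" "(g \<longlongrightarrow> 0) \<omega>"
  shows "((\<lambda>n. \<nu> (Y n)) \<longlongrightarrow> 0) \<omega>"
  by (rule Lim_null_comparison[OF _ assms(3)]) (simp add: nu_nonneg assms)

lemma null_seqs_plus:
  assumes "X \<in> null_seqs \<omega> \<nu> M" "Y \<in> null_seqs \<omega> \<nu> M"
  shows "(\<lambda>n. X n + Y n) \<in> null_seqs \<omega> \<nu> M"
proof -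
  have c: "X n \<in> carrier M" "Y n \<in> carrier M" for n using assms by (auto simp: mem_null_seqs mem_linf)
  have "((\<lambda>n. \<nu> (X n + Y n)) \<longlongrightarrow> 0) \<omega>"
    by (rule tendsto_nu_zeroI[where g = "\<lambda>n. \<nu> (X n) + \<nu> (Y n)"])
       (use assms c in \<open>auto simp: mem_null_seqs plus_closed nu_plus intro!: tendsto_add_zero\<close>)
  then show ?thesis using assms by (simp add: mem_null_seqs linf_plus)
qed

lemma null_seqs_uminus:
  "X \<in> null_seqs \<omega> \<nu> M \<Longrightarrow> (\<lambda>n. - X n) \<in> null_seqs \<omega> \<nu> M"
  by (auto simp: mem_null_seqs mem_linf uminus_closed nu_minus)

lemma null_seqs_diff:
  assumes "X \<in> null_seqs \<omega> \<nu> M" "Y \<in> null_seqs \<omega> \<nu> M"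
  shows "(\<lambda>n. X n - Y n) \<in> null_seqs \<omega> \<nu> M"
  using null_seqs_plus[OF assms(1) null_seqs_uminus[OF assms(2)]] by simp

lemma null_seqs_zero: "(\<lambda>n. 0) \<in> null_seqs \<omega> \<nu> M"
  by (simp add: mem_null_seqs linf_const zero_closed nu_zero)

lemma null_seqs_mult:
  assumes X: "X \<in> null_seqs \<omega> \<nu> M" and Y: "Y \<in> carrier (linf M)"
  shows "(\<lambda>n. Y n \<otimes>\<^bsub>M\<^esub> X n) \<in> null_seqs \<omega> \<nu> M" "(\<lambda>n. X n \<otimes>\<^bsub>M\<^esub> Y n) \<in> null_seqs \<omega> \<nu> M"
proof -
  obtain R where R: "\<And>n. norm (Y n) \<le> R" and c: "\<And>n. X n \<in> carrier M" "\<And>n. Y n \<in> carrier M"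
    using assms by (auto simp: mem_linf mem_null_seqs)
  have lim: "((\<lambda>n. R * \<nu> (X n)) \<longlongrightarrow> 0) \<omega>"
    using X by (auto simp: mem_null_seqs intro: tendsto_mult_right_zero)
  have le: "norm (Y n) * \<nu> (X n) \<le> R * \<nu> (X n)" for n
    by (intro mult_right_mono R nu_nonneg c)
  have "((\<lambda>n. \<nu> (Y n \<otimes>\<^bsub>M\<^esub> X n)) \<longlongrightarrow> 0) \<omega>"
    by (rule tendsto_nu_zeroI[OF _ _ lim]) (simp add: mult_closed c, rule order_trans[OF nu_mult_left[OF c(2,1)] le])
  moreover have "((\<lambda>n. \<nu> (X n \<otimes>\<^bsub>M\<^esub> Y n)) \<longlongrightarrow> 0) \<omega>"
    by (rule tendsto_nu_zeroI[OF _ _ lim]) (simp add: mult_closed c, rule order_trans[OF nu_mult_right[OF c] le])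
  ultimately show "(\<lambda>n. Y n \<otimes>\<^bsub>M\<^esub> X n) \<in> null_seqs \<omega> \<nu> M" "(\<lambda>n. X n \<otimes>\<^bsub>M\<^esub> Y n) \<in> null_seqs \<omega> \<nu> M"
    using X Y by (auto simp: mem_null_seqs linf_mult)
qed

lemma null_seqs_smult:
  assumes X: "X \<in> null_seqs \<omega> \<nu> M"
  shows "(\<lambda>n. c \<odot>\<^bsub>M\<^esub> X n) \<in> null_seqs \<omega> \<nu> M"
proof -
  have "((\<lambda>n. cmod c * \<nu> (X n)) \<longlongrightarrow> 0) \<omega>"
    using X by (auto simp: mem_null_seqs intro: tendsto_mult_right_zero)
  then have "((\<lambda>n. \<nu> (c \<odot>\<^bsub>M\<^esub> X n)) \<longlongrightarrow> 0) \<omega>"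
    by (rule tendsto_nu_zeroI[rotated 2])
       (use X in \<open>auto simp: mem_null_seqs mem_linf smult_closed nu_smult\<close>)
  then show ?thesis using X by (simp add: mem_null_seqs linf_smult)
qed

lemma null_seqs_involution:
  assumes X: "X \<in> null_seqs \<omega> \<nu> M"
  shows "(\<lambda>n. involution M (X n)) \<in> null_seqs \<omega> \<nu> M"
proof -
  have "((\<lambda>n. \<nu> (involution M (X n))) \<longlongrightarrow> 0) \<omega>"
    by (rule tendsto_nu_zeroI[where g = "\<lambda>n. \<nu> (X n)"])
       (use X in \<open>auto simp: mem_null_seqs mem_linf involution_closed nu_involution\<close>)
  then show ?thesis using X by (simp add: mem_null_seqs linf_involution)
qed

lemma ideal_null_seqs: "ideal (null_seqs \<omega> \<nu> M) (linf M)"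
proof (rule idealI[OF ring_linf])
  interpret L: ring "linf M" by (rule ring_linf)
  show "subgroup (null_seqs \<omega> \<nu> M) (add_monoid (linf M))"
  proof (rule group.subgroupI[OF L.a_group])
    fix X assume X: "X \<in> null_seqs \<omega> \<nu> M"
    then have "X \<in> carrier (linf M)" by (simp add: mem_null_seqs)
    then have "\<ominus>\<^bsub>linf M\<^esub> X = (\<lambda>n. - X n)"
      by (intro L.minus_equality) (simp_all add: linf_simps linf_uminus)
    then show "inv\<^bsub>add_monoid (linf M)\<^esub> X \<in> null_seqs \<omega> \<nu> M"
      using null_seqs_uminus[OF X] by (simp add: a_inv_def)
  qed (use null_seqs_zero null_seqs_plus in \<open>auto simp: linf_simps mem_null_seqs\<close>)
qed (auto simp: linf_simps null_seqs_mult)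

section \<open>Classes of sequences and the operations on them\<close>

abbreviation cls :: "(nat \<Rightarrow> 'b) \<Rightarrow> (nat \<Rightarrow> 'b) set" where
  "cls \<equiv> ultra_class \<omega> \<nu> M"

abbreviation U :: "(nat \<Rightarrow> 'b) set star_algebra" where
  "U \<equiv> ultrapower \<omega> \<nu> M"

text \<open>Addition of sequences is that of the ambient type, so cosets are plain translates and
  neither sequence has to be bounded.\<close>

lemma mem_cls: "X \<in> cls Y \<longleftrightarrow> (\<lambda>n. X n - Y n) \<in> null_seqs \<omega> \<nu> M"
proof
  assume "X \<in> cls Y"
  then show "(\<lambda>n. X n - Y n) \<in> null_seqs \<omega> \<nu> M"
    by (auto simp: ultra_class_def a_r_coset_def' linf_simps)
next
  assume "(\<lambda>n. X n - Y n) \<in> null_seqs \<omega> \<nu> M"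
  then show "X \<in> cls Y"
    by (auto simp: ultra_class_def a_r_coset_def' linf_simps intro!: bexI)
qed

lemma cls_eq_iff: "cls X = cls Y \<longleftrightarrow> (\<lambda>n. X n - Y n) \<in> null_seqs \<omega> \<nu> M"
proof
  assume "cls X = cls Y"
  then show "(\<lambda>n. X n - Y n) \<in> null_seqs \<omega> \<nu> M"
    using mem_cls[of X X] mem_cls[of X Y] null_seqs_zero by simp
next
  assume *: "(\<lambda>n. X n - Y n) \<in> null_seqs \<omega> \<nu> M"
  show "cls X = cls Y"
  proof (intro Set.set_eqI iffI)
    fix Z
    show "Z \<in> cls Y" if "Z \<in> cls X"
      using null_seqs_plus[OF that[unfolded mem_cls] *] by (simp add: mem_cls)
    show "Z \<in> cls X" if "Z \<in> cls Y"
      using null_seqs_diff[OF that[unfolded mem_cls] *] by (simp add: mem_cls)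
  qed
qed

lemma cls_self: "X \<in> cls X"
  by (simp add: mem_cls null_seqs_zero)

lemma cls_nonempty: "cls X \<noteq> {}"
  using cls_self by blast

lemma carrier_ultrapower: "carrier U = cls ` carrier (linf M)"
  by (auto simp: ultrapower_def star_quotient_def ring.defs FactRing_def A_RCOSETS_def'
      ultra_class_def)

lemma ultrapower_mult:
  assumes "X \<in> carrier (linf M)" "Y \<in> carrier (linf M)"
  shows "cls X \<otimes>\<^bsub>U\<^esub> cls Y = cls (\<lambda>n. X n \<otimes>\<^bsub>M\<^esub> Y n)"
  using ideal.rcoset_mult_add[OF ideal_null_seqs assms]
  by (simp add: ultrapower_def star_quotient_def ring.defs FactRing_def ultra_class_def linf_simps)

lemma ultrapower_add:
  assumes "X \<in> carrier (linf M)" "Y \<in> carrier (linf M)"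
  shows "cls X \<oplus>\<^bsub>U\<^esub> cls Y = cls (\<lambda>n. X n + Y n)"
proof -
  interpret I: ideal "null_seqs \<omega> \<nu> M" "linf M" by (rule ideal_null_seqs)
  show ?thesis
    using I.a_rcos_sum[OF assms]
    by (simp add: ultrapower_def star_quotient_def ring.defs FactRing_def ultra_class_def linf_simps)
qed

lemma ultrapower_one: "\<one>\<^bsub>U\<^esub> = cls (\<lambda>n. \<one>\<^bsub>M\<^esub>)"
  by (simp add: ultrapower_def star_quotient_def ring.defs FactRing_def ultra_class_def linf_simps)

text \<open>\<open>star_quotient\<close> takes a union over all representatives. It is a single
  class because scalar multiples of null sequences are null.\<close>

lemma ultrapower_smult:
  assumes X: "X \<in> carrier (linf M)"
  shows "c \<odot>\<^bsub>U\<^esub> cls X = cls (\<lambda>n. c \<odot>\<^bsub>M\<^esub> X n)"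
proof -
  have eq: "cls (\<lambda>n. c \<odot>\<^bsub>M\<^esub> Y n) = cls (\<lambda>n. c \<odot>\<^bsub>M\<^esub> X n)" if Y: "Y \<in> cls X" for Y
  proof -
    have D: "(\<lambda>n. Y n - X n) \<in> null_seqs \<omega> \<nu> M" using Y by (simp add: mem_cls)
    then have "c \<odot>\<^bsub>M\<^esub> (Y n - X n + X n) = c \<odot>\<^bsub>M\<^esub> (Y n - X n) + c \<odot>\<^bsub>M\<^esub> X n" for n
      using X by (intro smult_plus) (auto simp: mem_null_seqs mem_linf)
    then have "(\<lambda>n. c \<odot>\<^bsub>M\<^esub> Y n - c \<odot>\<^bsub>M\<^esub> X n) = (\<lambda>n. c \<odot>\<^bsub>M\<^esub> (Y n - X n))" by simp
    then show ?thesis using null_seqs_smult[OF D, of c] by (simp add: cls_eq_iff)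
  qed
  have "c \<odot>\<^bsub>U\<^esub> cls X = (\<Union>Y\<in>cls X. cls (\<lambda>n. c \<odot>\<^bsub>M\<^esub> Y n))"
    by (simp add: ultrapower_def star_quotient_def ring.defs ultra_class_def linf_simps)
  also have "\<dots> = (\<Union>Y\<in>cls X. cls (\<lambda>n. c \<odot>\<^bsub>M\<^esub> X n))"
    by (rule SUP_cong[OF refl eq])
  finally show ?thesis using cls_nonempty[of X] by simp
qed

lemma ultrapower_involution:
  assumes X: "X \<in> carrier (linf M)"
  shows "involution U (cls X) = cls (\<lambda>n. involution M (X n))"
proof -
  have eq: "cls (\<lambda>n. involution M (Y n)) = cls (\<lambda>n. involution M (X n))" if Y: "Y \<in> cls X" for Y
  proof -
    have D: "(\<lambda>n. Y n - X n) \<in> null_seqs \<omega> \<nu> M" using Y by (simp add: mem_cls)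
    then have "involution M (Y n - X n + X n) = involution M (Y n - X n) + involution M (X n)" for n
      using X by (intro involution_plus) (auto simp: mem_null_seqs mem_linf)
    then have "(\<lambda>n. involution M (Y n) - involution M (X n)) = (\<lambda>n. involution M (Y n - X n))" by simp
    then show ?thesis using null_seqs_involution[OF D] by (simp add: cls_eq_iff)
  qed
  have "involution U (cls X) = (\<Union>Y\<in>cls X. cls (\<lambda>n. involution M (Y n)))"
    by (simp add: ultrapower_def star_quotient_def ring.defs ultra_class_def linf_simps)
  also have "\<dots> = (\<Union>Y\<in>cls X. cls (\<lambda>n. involution M (X n)))"
    by (rule SUP_cong[OF refl eq])
  finally show ?thesis using cls_nonempty[of X] by simp
qed

lemma cls_in_central_ultrapower:
  assumes X: "X \<in> carrier (linf M)"
  shows "cls X \<in> carrier (central_ultrapower \<omega> \<nu> M) \<longleftrightarrow>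
    (\<forall>b\<in>carrier M. (\<lambda>n. X n \<otimes>\<^bsub>M\<^esub> b - b \<otimes>\<^bsub>M\<^esub> X n) \<in> null_seqs \<omega> \<nu> M)"
  using X by (auto simp: central_ultrapower_def relative_commutant_def carrier_ultrapower
      ultrapower_mult linf_const cls_eq_iff)

lemma carrier_central_ultrapower_subset: "carrier (central_ultrapower \<omega> \<nu> M) \<subseteq> carrier U"
  by (auto simp: central_ultrapower_def relative_commutant_def)

end

lemma star_hom_restrict:
  assumes "h \<in> star_hom M M'" "S \<subseteq> carrier M" "h ` S \<subseteq> T"
  shows "h \<in> star_hom (M\<lparr>carrier := S\<rparr>) (M'\<lparr>carrier := T\<rparr>)"
  using assms unfolding star_hom_def ring_hom_def by (auto simp: subset_iff)

section \<open>The two instances: A with its norm, N with the 2-norm\<close>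

lemma ultrapower_base_cstar_alg: "ultrapower_base (cstar_alg :: 'a::unital_cstar_algebra star_algebra) norm"
proof unfold_locales
  show "norm (x \<otimes>\<^bsub>cstar_alg\<^esub> y) \<le> norm y * norm x" for x y :: 'a
    using norm_mult_ineq[of x y] by (simp add: cstar_alg_def mult.commute)
qed (auto simp: cstar_alg_def mult.assoc distrib_left distrib_right cscale_add_right star_add
       norm_mult_ineq norm_cscale norm_triangle_ineq)

lemma cstar_alg_simps:
  "carrier (cstar_alg :: 'a::unital_cstar_algebra star_algebra) = UNIV"
  "mult (cstar_alg :: 'a star_algebra) = (*)" "\<one>\<^bsub>cstar_alg\<^esub> = (1 :: 'a)"
  "smult (cstar_alg :: 'a star_algebra) = (*\<^sub>C)" "involution (cstar_alg :: 'a star_algebra) = star"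
  by (simp_all add: cstar_alg_def)

context tracial_gns
begin

lemma gns_closure_simps:
  "carrier (gns_closure \<pi>) = N" "mult (gns_closure \<pi>) = (o\<^sub>L)" "\<one>\<^bsub>gns_closure \<pi>\<^esub> = id_blinfun"
  "\<zero>\<^bsub>gns_closure \<pi>\<^esub> = 0" "add (gns_closure \<pi>) = (+)" "smult (gns_closure \<pi>) = blinfun_cscale"
  "involution (gns_closure \<pi>) = op_adjoint"
  by (simp_all add: gns_closure_def bounded_ops_def)

lemma two_norm_N: "T \<in> N \<Longrightarrow> two_norm \<xi> T = norm (T \<xi>)"
  by (rule two_norm_eq[OF N_subset])

lemma ultrapower_base_gns_closure: "ultrapower_base (gns_closure \<pi>) (two_norm \<xi>)"
proof (unfold_locales, unfold gns_closure_simps)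
  show zero: "0 \<in> N" using pi_in_N[of 0] by (simp add: pi_zero)
  show "id_blinfun \<in> N" using pi_in_N[of 1] by (simp add: pi_one)
  show "two_norm \<xi> (0 :: 'h \<Rightarrow>\<^sub>L 'h) = 0" using zero by (simp add: two_norm_N)
  show "op_adjoint (S + T) = op_adjoint S + op_adjoint T" if "S \<in> N" "T \<in> N" for S T
    using that by (simp add: op_adjoint_plus N_subset)
  show "norm (op_adjoint T) \<le> norm T" if "T \<in> N" for T
    using that by (simp add: norm_op_adjoint_le N_subset)
  show "two_norm \<xi> (S o\<^sub>L T) \<le> norm S * two_norm \<xi> T" if "S \<in> N" "T \<in> N" for S T
    using that norm_blinfun[of S "T \<xi>"] by (simp add: two_norm_N N_compose)
  show "two_norm \<xi> (S o\<^sub>L T) \<le> norm T * two_norm \<xi> S" if "S \<in> N" "T \<in> N" for S T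
    using that norm_compose_xi_le[of S T] by (simp add: two_norm_N N_compose)
  show "two_norm \<xi> (S + T) \<le> two_norm \<xi> S + two_norm \<xi> T" if "S \<in> N" "T \<in> N" for S T
    using that norm_triangle_ineq[of "S \<xi>" "T \<xi>"] by (simp add: two_norm_N N_plus blinfun.add_left)
  show "two_norm \<xi> (- T) = two_norm \<xi> T" if "T \<in> N" for T
    using that by (simp add: two_norm_N N_uminus blinfun.minus_left)
  show "two_norm \<xi> (op_adjoint T) \<le> two_norm \<xi> T" if "T \<in> N" for T
    using that by (simp add: two_norm_N N_adjoint norm_adjoint_xi)
  show "two_norm \<xi> (blinfun_cscale c T) \<le> cmod c * two_norm \<xi> T" if "T \<in> N" for c T
    using that by (simp add: two_norm_N N_cscale norm_cscale)
qed (auto simp: N_plus N_uminus N_compose N_cscale N_adjoint norm_blinfun_compose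
    norm_blinfun_cscale two_norm_N cscale_add_right
    intro!: blinfun_eqI simp: blinfun.bilinear_simps)

lemma two_sided_seminorm_gns: "two_sided_seminorm (\<lambda>a. norm (\<pi> a \<xi>)) 2"
proof
  show "norm (\<pi> (a + b) \<xi>) \<le> norm (\<pi> a \<xi>) + norm (\<pi> b \<xi>)" for a b
    by (simp add: pi_add blinfun.add_left norm_triangle_ineq)
  show "norm (\<pi> (star a) \<xi>) = norm (\<pi> a \<xi>)" for a
    by (simp add: pi_star norm_adjoint_xi pi_in_N)
  show "norm (\<pi> (a * b) \<xi>) \<le> 2 * norm a * norm (\<pi> b \<xi>)" for a b
    by (simp add: pi_mult norm_pi_apply_le)
qed simp_all

end

section \<open>The natural map between the ultrapowers\<close>

locale separable_tracial_gns = tracial_gns \<tau> \<pi> \<xi>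
  for \<tau> :: "'a::unital_cstar_algebra \<Rightarrow> complex"
    and \<pi> :: "'a \<Rightarrow> ('h::complex_hilbert_space \<Rightarrow>\<^sub>L 'h)"
    and \<xi> :: 'h +
  fixes \<omega> :: "nat filter"
  assumes sep: "separable_space (euclidean :: 'a topology)"
    and free: "free_ultrafilter \<omega>"
begin

sublocale A: ultrapower_base "cstar_alg :: 'a star_algebra" norm \<omega>
  by (rule ultrapower_base_cstar_alg)

sublocale B: ultrapower_base "gns_closure \<pi>" "two_norm \<xi>" \<omega>
  by (rule ultrapower_base_gns_closure)

sublocale J: two_sided_seminorm "\<lambda>a. norm (\<pi> a \<xi>)" 2 \<omega>
  by (rule two_sided_seminorm_gns)

text \<open>Freeness excludes single points and hence finite sets, so ordinary limits are limits
  along \<omega>.\<close>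

lemma omega_le: "\<omega> \<le> sequentially"
  unfolding cofinite_eq_sequentially[symmetric] le_filter_def eventually_cofinite
proof (intro allI impI)
  fix P :: "nat \<Rightarrow> bool" assume "finite {n. \<not> P n}"
  then have "eventually (\<lambda>n. \<forall>m\<in>{n. \<not> P n}. n \<noteq> m) \<omega>"
    using free by (intro eventually_ball_finite) (auto simp: free_ultrafilter_def)
  then show "eventually P \<omega>" by (rule eventually_mono) blast
qed

lemma mem_linf_A: "a \<in> carrier (linf cstar_alg) \<longleftrightarrow> bounded (range (a :: nat \<Rightarrow> 'a))"
  by (simp add: linf_def cstar_alg_def)

lemma mem_linf_B:
  "X \<in> carrier (linf (gns_closure \<pi>)) \<longleftrightarrow> (\<forall>n. X n \<in> N) \<and> (\<exists>R\<ge>0. \<forall>n. norm (X n) \<le> R)"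
  by (simp add: B.mem_linf gns_closure_simps)

lemma pi_linf:
  assumes "a \<in> carrier (linf cstar_alg)"
  shows "(\<lambda>n. \<pi> (a n)) \<in> carrier (linf (gns_closure \<pi>))"
proof -
  obtain R where R: "R \<ge> 0" "\<And>n. norm (a n) \<le> R"
    using assms by (auto simp: mem_linf_A bounded_range_iff)
  have "norm (\<pi> (a n)) \<le> 2 * R" for n using norm_pi_le[of "a n"] R(2)[of n] by simp
  then show ?thesis using R by (auto simp: mem_linf_B pi_in_N intro!: exI[of _ "2 * R"])
qed

lemma J_null_iff:
  "a \<in> J.null \<longleftrightarrow> bounded (range a) \<and> (\<lambda>n. \<pi> (a n)) \<in> null_seqs \<omega> (two_norm \<xi>) (gns_closure \<pi>)"
  using pi_linf[of a]
  by (auto simp: J.null_def B.mem_null_seqs mem_linf_A two_norm_N pi_in_N)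

text \<open>The operator norm dominates the 2-norm up to the factor \<open>2 * norm \<xi>\<close>;
  this makes the natural map independent of representatives.\<close>

lemma null_A_subset:
  assumes "a \<in> null_seqs \<omega> norm (cstar_alg :: 'a star_algebra)"
  shows "a \<in> J.null"
proof -
  have *: "bounded (range a)" "((\<lambda>n. norm (a n)) \<longlongrightarrow> 0) \<omega>"
    using assms by (auto simp: A.mem_null_seqs mem_linf_A)
  have "((\<lambda>n. norm (a n) * (2 * norm \<xi>)) \<longlongrightarrow> 0) \<omega>"
    by (rule tendsto_mult_left_zero) (rule *)
  then have "((\<lambda>n. norm (\<pi> (a n) \<xi>)) \<longlongrightarrow> 0) \<omega>"
    by (rule Lim_null_comparison[rotated])
       (use norm_pi_apply_le[of "a _" \<xi>] in \<open>simp add: ac_simps\<close>)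
  with * show ?thesis by (simp add: J.null_def)
qed

abbreviation nat_map :: "(nat \<Rightarrow> 'a) set \<Rightarrow> (nat \<Rightarrow> 'h \<Rightarrow>\<^sub>L 'h) set" where
  "nat_map \<equiv> natural_map \<omega> \<pi> \<xi>"

lemma natural_map_cls:
  assumes a: "a \<in> carrier (linf cstar_alg)"
  shows "nat_map (A.cls a) = B.cls (\<lambda>n. \<pi> (a n))"
proof -
  have eq: "B.cls (\<lambda>n. \<pi> (b n)) = B.cls (\<lambda>n. \<pi> (a n))" if b: "b \<in> A.cls a" for b
    using null_A_subset[OF b[unfolded A.mem_cls]] by (simp add: J_null_iff B.cls_eq_iff pi_diff)
  have "nat_map (A.cls a) = (\<Union>b\<in>A.cls a. B.cls (\<lambda>n. \<pi> (b n)))" by (simp add: natural_map_def)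
  also have "\<dots> = (\<Union>b\<in>A.cls a. B.cls (\<lambda>n. \<pi> (a n)))" by (rule SUP_cong[OF refl eq])
  finally show ?thesis using A.cls_nonempty[of a] by simp
qed

lemma natural_map_star_hom: "nat_map \<in> star_hom A.U B.U"
proof -
  have "nat_map \<in> ring_hom A.U B.U"
  proof (rule ring_hom_memI)
    fix X Y assume "X \<in> carrier A.U" "Y \<in> carrier A.U"
    then obtain x y where xy: "x \<in> carrier (linf cstar_alg)" "y \<in> carrier (linf cstar_alg)"
      and XY: "X = A.cls x" "Y = A.cls y" by (auto simp: A.carrier_ultrapower)
    show "nat_map (X \<otimes>\<^bsub>A.U\<^esub> Y) = nat_map X \<otimes>\<^bsub>B.U\<^esub> nat_map Y"
      using A.linf_mult[OF xy]
      by (simp add: XY A.ultrapower_mult B.ultrapower_mult natural_map_cls xy pi_linf cstar_alg_simps pi_mult gns_closure_simps)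
    show "nat_map (X \<oplus>\<^bsub>A.U\<^esub> Y) = nat_map X \<oplus>\<^bsub>B.U\<^esub> nat_map Y"
      using A.linf_plus[OF xy]
      by (simp add: XY A.ultrapower_add B.ultrapower_add natural_map_cls xy pi_linf pi_add)
    show "nat_map X \<in> carrier B.U"
      by (simp add: XY natural_map_cls xy B.carrier_ultrapower pi_linf)
  next
    show "nat_map \<one>\<^bsub>A.U\<^esub> = \<one>\<^bsub>B.U\<^esub>"
      using A.linf_const[OF A.one_closed]
      by (simp add: A.ultrapower_one B.ultrapower_one natural_map_cls cstar_alg_simps pi_one gns_closure_simps)
  qed
  moreover have "nat_map (c \<odot>\<^bsub>A.U\<^esub> X) = c \<odot>\<^bsub>B.U\<^esub> nat_map X"
    "nat_map (involution A.U X) = involution B.U (nat_map X)" if X: "X \<in> carrier A.U" for c X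
  proof -
    obtain x where x: "x \<in> carrier (linf cstar_alg)" "X = A.cls x"
      using X by (auto simp: A.carrier_ultrapower)
    show "nat_map (c \<odot>\<^bsub>A.U\<^esub> X) = c \<odot>\<^bsub>B.U\<^esub> nat_map X"
      using A.linf_smult[OF x(1), of c]
      by (simp add: x A.ultrapower_smult B.ultrapower_smult natural_map_cls pi_linf cstar_alg_simps pi_cscale gns_closure_simps)
    show "nat_map (involution A.U X) = involution B.U (nat_map X)"
      using A.linf_involution[OF x(1)]
      by (simp add: x A.ultrapower_involution B.ultrapower_involution natural_map_cls pi_linf cstar_alg_simps pi_star gns_closure_simps)
  qed
  ultimately show ?thesis by (simp add: star_hom_def)
qed

text \<open>Approximation in each coordinate with tolerance \<open>1 / real (Suc n)\<close>; the
  bound \<open>8 * R\<close> is common to all \<open>n\<close>, so the lift is bounded.\<close>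

lemma exists_lift:
  assumes X: "X \<in> carrier (linf (gns_closure \<pi>))"
  shows "\<exists>a\<in>carrier (linf cstar_alg). B.cls (\<lambda>n. \<pi> (a n)) = B.cls X"
proof -
  obtain R where R: "\<And>n. norm (X n) \<le> R" and XN: "\<And>n. X n \<in> N"
    using X by (auto simp: mem_linf_B)
  have "\<exists>a. norm a \<le> 8 * R \<and> norm (\<pi> a \<xi> - X n \<xi>) < 1 / real (Suc n)" for n
    by (rule kaplansky_density[OF XN R]) simp
  then obtain a where a: "\<And>n. norm (a n) \<le> 8 * R" "\<And>n. norm (\<pi> (a n) \<xi> - X n \<xi>) < 1 / real (Suc n)"
    by metis
  have al: "a \<in> carrier (linf cstar_alg)"
    using a(1) by (auto simp: mem_linf_A bounded_iff)
  have "((\<lambda>n. 1 / real (Suc n)) \<longlongrightarrow> 0) \<omega>"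
    by (rule filterlim_mono[OF LIMSEQ_Suc[OF lim_1_over_n] order_refl omega_le])
  then have "((\<lambda>n. two_norm \<xi> (\<pi> (a n) - X n)) \<longlongrightarrow> 0) \<omega>"
    by (rule B.tendsto_nu_zeroI[rotated 2])
       (use a(2) in \<open>auto simp: gns_closure_simps N_diff pi_in_N XN two_norm_N blinfun.diff_left less_imp_le\<close>)
  then have "(\<lambda>n. \<pi> (a n) - X n) \<in> null_seqs \<omega> (two_norm \<xi>) (gns_closure \<pi>)"
    using B.linf_diff[OF pi_linf[OF al] X] by (simp add: B.mem_null_seqs)
  then show ?thesis using al by (auto simp: B.cls_eq_iff)
qed

lemma natural_map_surj: "nat_map ` carrier A.U = carrier B.U"
proof
  show "nat_map ` carrier A.U \<subseteq> carrier B.U"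
    by (auto simp: A.carrier_ultrapower natural_map_cls B.carrier_ultrapower pi_linf)
  show "carrier B.U \<subseteq> nat_map ` carrier A.U"
  proof
    fix Y assume "Y \<in> carrier B.U"
    then obtain X where X: "X \<in> carrier (linf (gns_closure \<pi>))" "Y = B.cls X"
      by (auto simp: B.carrier_ultrapower)
    obtain a where "a \<in> carrier (linf cstar_alg)" "B.cls (\<lambda>n. \<pi> (a n)) = B.cls X"
      using exists_lift[OF X(1)] by blast
    then show "Y \<in> nat_map ` carrier A.U"
      by (metis A.carrier_ultrapower X(2) imageI natural_map_cls)
  qed
qed

section \<open>The natural map between the relative commutants\<close>

abbreviation CA :: "(nat \<Rightarrow> 'a) set star_algebra" where
  "CA \<equiv> central_ultrapower \<omega> norm cstar_alg"

abbreviation CB :: "(nat \<Rightarrow> 'h \<Rightarrow>\<^sub>L 'h) set star_algebra" where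
  "CB \<equiv> central_ultrapower \<omega> (two_norm \<xi>) (gns_closure \<pi>)"

text \<open>It suffices to test commutation on the image of \<open>A\<close>, which is dense in \<open>N\<close> for the
  2-norm.\<close>

lemma natural_map_central:
  assumes X: "X \<in> carrier CA"
  shows "nat_map X \<in> carrier CB"
proof -
  obtain a where a: "a \<in> carrier (linf cstar_alg)" "X = A.cls a"
    using X A.carrier_central_ultrapower_subset by (auto simp: A.carrier_ultrapower)
  have pa: "(\<lambda>n. \<pi> (a n)) \<in> carrier (linf (gns_closure \<pi>))" by (rule pi_linf[OF a(1)])
  obtain R where R: "0 \<le> R" "\<And>n. norm (\<pi> (a n)) \<le> R" using pa by (auto simp: mem_linf_B)
  have comm: "(\<lambda>n. a n * b - b * a n) \<in> J.null" for b
    using X A.cls_in_central_ultrapower[OF a(1)]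
    by (intro null_A_subset) (simp add: a(2) cstar_alg_simps)
  have "(\<lambda>n. (\<pi> (a n) o\<^sub>L T) - (T o\<^sub>L \<pi> (a n))) \<in> null_seqs \<omega> (two_norm \<xi>) (gns_closure \<pi>)"
    if T: "T \<in> N" for T
  proof -
    have lin: "(\<lambda>n. (\<pi> (a n) o\<^sub>L T) - (T o\<^sub>L \<pi> (a n))) \<in> carrier (linf (gns_closure \<pi>))"
      using B.linf_diff[OF B.linf_mult[OF pa B.linf_const] B.linf_mult[OF B.linf_const pa], of T T] T
      by (simp add: gns_closure_simps)
    have "((\<lambda>n. two_norm \<xi> ((\<pi> (a n) o\<^sub>L T) - (T o\<^sub>L \<pi> (a n)))) \<longlongrightarrow> 0) \<omega>"
    proof (rule tendstoI)
      fix e :: real assume e: "0 < e"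
      define d where "d = e / (2 * (2 * R + 1))"
      have d: "0 < d" "2 * R * d < e / 2"
        using e R(1) by (auto simp: d_def field_simps add_nonneg_pos)
      obtain b where b: "norm (\<pi> b \<xi> - T \<xi>) < d" using pi_xi_dense[OF d(1)] by blast
      define D where "D = T - \<pi> b"
      have D: "D \<in> N" unfolding D_def by (intro N_diff T pi_in_N)
      have nD: "norm (D \<xi>) \<le> d" using b by (simp add: D_def blinfun.diff_left norm_minus_commute)
      have "eventually (\<lambda>n. norm (\<pi> (a n * b - b * a n) \<xi>) < e / 2) \<omega>"
        using comm[of b] e by (intro order_tendstoD(2)[of _ 0]) (auto simp: J.null_def)
      then show "eventually (\<lambda>n. dist (two_norm \<xi> ((\<pi> (a n) o\<^sub>L T) - (T o\<^sub>L \<pi> (a n)))) 0 < e) \<omega>"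
      proof eventually_elim
        case (elim n)
        \<comment> \<open>Replace \<open>T\<close> by a nearby \<open>\<pi> b\<close>. The remainder
          \<open>D\<close> is small only in the 2-norm, so the term
          \<open>D (\<pi> (a n) \<xi>)\<close> calls for the bound for right multiplication.\<close>
        have "\<pi> (a n) (T \<xi>) - T (\<pi> (a n) \<xi>)
          = \<pi> (a n) (D \<xi>) - D (\<pi> (a n) \<xi>) + \<pi> (a n * b - b * a n) \<xi>"
          by (simp add: D_def pi_diff pi_mult blinfun.bilinear_simps)
        also have "norm \<dots> \<le> R * d + R * d + norm (\<pi> (a n * b - b * a n) \<xi>)"
        proof (intro norm_triangle_le norm_triangle_le_diff add_mono order_refl)
          show "norm (\<pi> (a n) (D \<xi>)) \<le> R * d"
            by (rule order_trans[OF norm_blinfun]) (use R nD in \<open>auto intro!: mult_mono\<close>)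
          show "norm (D (\<pi> (a n) \<xi>)) \<le> R * d"
            by (rule order_trans[OF norm_compose_xi_le[OF D pi_in_N]])
               (use R nD in \<open>auto intro!: mult_mono\<close>)
        qed
        also have "\<dots> < e" using elim d by simp
        finally show ?case
          using T by (simp add: two_norm_N N_diff N_compose pi_in_N blinfun.diff_left)
      qed
    qed
    with lin show ?thesis by (simp add: B.mem_null_seqs)
  qed
  then show ?thesis
    by (simp add: a natural_map_cls B.cls_in_central_ultrapower[OF pa] gns_closure_simps)
qed

text \<open>Commutators with a bounded sequence are Lipschitz in \<open>b\<close> uniformly in
  \<open>n\<close>, so it is enough to treat a countable dense subset, to which the diagonal
  argument applies.\<close>

lemma exists_central_lift:
  assumes a: "bounded (range a)"
    and ab: "\<And>b. (\<lambda>n. a n * b - b * a n) \<in> J.null"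
  shows "\<exists>a'. bounded (range a') \<and> (\<lambda>n. a' n - a n) \<in> J.null \<and>
    (\<forall>b. ((\<lambda>n. norm (a' n * b - b * a' n)) \<longlongrightarrow> 0) \<omega>)"
proof -
  obtain D :: "'a set" where D: "countable D" "closure D = UNIV"
    using sep by (auto simp: separable_space_def)
  then have ne: "D \<noteq> {}" by auto
  obtain a' where a': "bounded (range a')" "(\<lambda>n. a' n - a n) \<in> J.null"
    and lim: "\<And>j. ((\<lambda>n. norm (a' n * from_nat_into D j - from_nat_into D j * a' n)) \<longlongrightarrow> 0) \<omega>"
    using J.central_lift[OF omega_le a, of "from_nat_into D"] ab by blast
  obtain R where R: "0 \<le> R" "\<And>n. norm (a' n) \<le> R" using a'(1) by (auto simp: bounded_range_iff)
  have "((\<lambda>n. norm (a' n * b - b * a' n)) \<longlongrightarrow> 0) \<omega>" for b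
  proof (rule tendstoI)
    fix e :: real assume e: "0 < e"
    define d where "d = e / (2 * (2 * R + 1))"
    have d: "0 < d" "2 * R * d < e / 2"
      using e R(1) by (auto simp: d_def field_simps add_nonneg_pos)
    have "b \<in> closure D" using D by simp
    then obtain c where c: "c \<in> D" "norm (b - c) < d"
      using d(1) by (auto simp: closure_approachable dist_norm norm_minus_commute)
    obtain j where j: "c = from_nat_into D j" using from_nat_into_surj[OF D(1) c(1)] by metis
    have "eventually (\<lambda>n. norm (a' n * c - c * a' n) < e / 2) \<omega>"
      using lim[of j] e unfolding j by (intro order_tendstoD(2)[of _ 0]) auto
    then show "eventually (\<lambda>n. dist (norm (a' n * b - b * a' n)) 0 < e) \<omega>"
    proof eventually_elim
      case (elim n)
      have "a' n * b - b * a' n = a' n * (b - c) - (b - c) * a' n + (a' n * c - c * a' n)"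
        by (simp add: algebra_simps)
      also have "norm \<dots> \<le> R * d + d * R + norm (a' n * c - c * a' n)"
      proof (rule norm_triangle_le, rule add_right_mono, rule norm_triangle_le_diff, rule add_mono)
        show "norm (a' n * (b - c)) \<le> R * d" "norm ((b - c) * a' n) \<le> d * R"
          by (rule order_trans[OF norm_mult_ineq], use R c d in \<open>auto intro!: mult_mono\<close>)+
      qed
      also have "\<dots> < e" using elim d by (simp add: mult.commute)
      finally show ?case by simp
    qed
  qed
  with a' show ?thesis by blast
qed

lemma natural_map_central_surj: "nat_map ` carrier CA = carrier CB"
proof
  show "nat_map ` carrier CA \<subseteq> carrier CB" using natural_map_central by blast
  show "carrier CB \<subseteq> nat_map ` carrier CA"
  proof
    fix Y assume Y: "Y \<in> carrier CB"
    then obtain X where X: "X \<in> carrier (linf (gns_closure \<pi>))" "Y = B.cls X"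
      using B.carrier_central_ultrapower_subset by (auto simp: B.carrier_ultrapower)
    obtain a where a: "a \<in> carrier (linf cstar_alg)" "B.cls (\<lambda>n. \<pi> (a n)) = B.cls X"
      using exists_lift[OF X(1)] by blast
    have ba: "bounded (range a)" using a(1) by (simp add: mem_linf_A)
    \<comment> \<open>Centrality of \<open>Y\<close>, tested on \<open>\<pi> b\<close>, makes the
      commutators of the lift null in the 2-norm, though not yet in the operator norm.\<close>
    have "(\<lambda>n. a n * b - b * a n) \<in> J.null" for b
    proof -
      have "bounded (range (\<lambda>n. a n * b - b * a n))"
        using bounded_minus_comp[OF bounded_range_mult[OF ba, of "\<lambda>_. b"] bounded_range_mult[OF _ ba, of "\<lambda>_. b"]]
        by simp
      moreover have "\<pi> b \<in> carrier (gns_closure \<pi>)" by (simp add: gns_closure_simps pi_in_N)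
      ultimately show ?thesis
        using Y unfolding X(2) a(2)[symmetric] B.cls_in_central_ultrapower[OF pi_linf[OF a(1)]]
        by (auto simp: J_null_iff pi_diff pi_mult gns_closure_simps)
    qed
    then obtain a' where a': "bounded (range a')" "(\<lambda>n. a' n - a n) \<in> J.null"
      "\<And>b. ((\<lambda>n. norm (a' n * b - b * a' n)) \<longlongrightarrow> 0) \<omega>"
      using exists_central_lift[OF ba] by blast
    have al: "a' \<in> carrier (linf cstar_alg)" using a'(1) by (simp add: mem_linf_A)
    have "(\<lambda>n. a' n * b - b * a' n) \<in> null_seqs \<omega> norm cstar_alg" for b
    proof -
      have "b \<in> carrier cstar_alg" by (simp add: cstar_alg_simps)
      then show ?thesis
        using A.linf_diff[OF A.linf_mult[OF al A.linf_const] A.linf_mult[OF A.linf_const al], of b b] a'(3)[of b]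
        by (simp add: A.mem_null_seqs cstar_alg_simps)
    qed
    then have "A.cls a' \<in> carrier CA"
      by (simp add: A.cls_in_central_ultrapower[OF al] cstar_alg_simps)
    \<comment> \<open>The correction \<open>a' - a\<close> is null in the 2-norm: it may change the
      class over A, but not its image.\<close>
    moreover have "nat_map (A.cls a') = Y"
      using a'(2) unfolding natural_map_cls[OF al] X(2) a(2)[symmetric] B.cls_eq_iff
      by (simp add: J_null_iff pi_diff)
    ultimately show "Y \<in> nat_map ` carrier CA" by blast
  qed
qed

lemma natural_map_central_star_hom: "nat_map \<in> star_hom CA CB"
proof -
  have "nat_map \<in> star_hom (A.U\<lparr>carrier := carrier CA\<rparr>) (B.U\<lparr>carrier := carrier CB\<rparr>)"
    using natural_map_star_hom A.carrier_central_ultrapower_subset natural_map_central_surj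
    by (intro star_hom_restrict) auto
  then show ?thesis by (simp add: central_ultrapower_def)
qed

end

theorem theorem3p3:
  fixes \<tau> :: "'a::unital_cstar_algebra \<Rightarrow> complex"
    and \<pi> :: "'a \<Rightarrow> ('h::complex_hilbert_space \<Rightarrow>\<^sub>L 'h)"
    and \<xi> :: 'h
    and \<omega> :: "nat filter"
  assumes "separable_space (euclidean :: 'a topology)"
    and "state \<tau>" and "tracial \<tau>" and "faithful \<tau>"
    and "gns_representation \<tau> \<pi> \<xi>"
    and "free_ultrafilter \<omega>"
  shows "natural_map \<omega> \<pi> \<xi> \<in>
           star_hom (ultrapower \<omega> norm (cstar_alg :: 'a star_algebra))
                    (ultrapower \<omega> (two_norm \<xi>) (gns_closure \<pi>)) \<and>
         natural_map \<omega> \<pi> \<xi> ` carrier (ultrapower \<omega> norm (cstar_alg :: 'a star_algebra)) =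
           carrier (ultrapower \<omega> (two_norm \<xi>) (gns_closure \<pi>)) \<and>
         natural_map \<omega> \<pi> \<xi> \<in>
           star_hom (central_ultrapower \<omega> norm (cstar_alg :: 'a star_algebra))
                    (central_ultrapower \<omega> (two_norm \<xi>) (gns_closure \<pi>)) \<and>
         natural_map \<omega> \<pi> \<xi> ` carrier (central_ultrapower \<omega> norm (cstar_alg :: 'a star_algebra)) =
           carrier (central_ultrapower \<omega> (two_norm \<xi>) (gns_closure \<pi>))"
proof -
  interpret separable_tracial_gns \<tau> \<pi> \<xi> \<omega>
    using assms by unfold_locales
  show ?thesis
    using natural_map_star_hom natural_map_surj natural_map_central_star_hom natural_map_central_surj
    by blast
qed

end
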